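(* Let $\overline{\mathbb{Q}}$ denote the field of algebraic numbers, viewed as a subfield of $\mathbb{C}$ via a fixed embedding. Let $$\mathcal T := \overline{\mathbb{Q}}[\cos(\alpha),\sin(\alpha) : \alpha\in\overline{\mathbb{Q}}]\subseteq \mathbb C$$ be the $\overline{\mathbb{Q}}$-subalgebra of $\mathbb{C}$ generated by the values of cosine and sine at all algebraic points. Let $\mathcal A:=\overline{\mathbb{Q}}[(X_\alpha, Y_\alpha)_{\alpha\in\overline{\mathbb{Q}}}]$ be the polynomial ring over $\overline{\mathbb{Q}}$ in the countably many variables $X_\alpha, Y_\alpha$ ($\alpha\in\overline{\mathbb{Q}}$), and let $\mathrm{ev}:\mathcal A\to\mathcal T$ be the $\overline{\mathbb{Q}}$-algebra homomorphism determined by $\mathrm{ev}(X_\alpha)=\cos(\alpha)$ and $\mathrm{ev}(Y_\alpha)=\sin(\alpha)$ for all $\alpha\in\overline{\mathbb{Q}}$. Let $\mathfrak I$ be the ideal of $\mathcal A$ generated by all polynomials $$X_\alpha^2+Y_\alpha^2-1,\quad X_{\alpha+\beta}-X_\alpha X_\beta +Y_\alpha Y_\beta, \quad Y_{\alpha+\beta}-Y_\alpha X_\beta-X_\alpha Y_\beta,$$ for $\alpha,\beta\in\overline{\mathbb{Q}}$. Then $\mathfrak I\subseteq\ker(\mathrm{ev})$, and the induced $\overline{\mathbb{Q}}$-algebra homomorphism $\overline{\mathrm{ev}}:\mathcal A/\mathfrak I\to\mathcal T$ is an isomorphism; equivalently, $\ker(\mathrm{ev})=\mathfrak I$.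
   Context: Each element of $\mathcal A$ is a polynomial with algebraic coefficients in only finitely many of the variables $X_\alpha, Y_\alpha$. *)

theory Defs
  imports Complex_Main "HOL-Library.Poly_Mapping" "HOL-Computational_Algebra.Polynomial"
begin

text \<open>Variables X_a and Y_a, indexed by complex numbers (only algebraic indices are
  admitted in the ring A below).\<close>
datatype var = Xv complex | Yv complex

fun var_index :: "var \<Rightarrow> complex" where
  "var_index (Xv a) = a"
| "var_index (Yv a) = a"

type_synonym mpoly = "(var \<Rightarrow>\<^sub>0 nat) \<Rightarrow>\<^sub>0 complex"

definition PVar :: "var \<Rightarrow> mpoly" where
  "PVar v = Poly_Mapping.single (Poly_Mapping.single v 1) 1"

definition PX :: "complex \<Rightarrow> mpoly" where "PX a = PVar (Xv a)"
definition PY :: "complex \<Rightarrow> mpoly" where "PY a = PVar (Yv a)"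

definition Aring :: "mpoly set" where
  "Aring = {p :: mpoly. (\<forall>m. algebraic (Poly_Mapping.lookup p m)) \<and>
               (\<forall>m\<in>Poly_Mapping.keys p. \<forall>v\<in>Poly_Mapping.keys (m :: var \<Rightarrow>\<^sub>0 nat). algebraic (var_index v))}"

fun var_val :: "var \<Rightarrow> complex" where
  "var_val (Xv a) = cos a"
| "var_val (Yv a) = sin a"

definition ev :: "mpoly \<Rightarrow> complex" where
  "ev p = (\<Sum>m\<in>Poly_Mapping.keys p. Poly_Mapping.lookup p m * (\<Prod>v\<in>Poly_Mapping.keys m. var_val v ^ Poly_Mapping.lookup m v))"

definition gens :: "mpoly set" where
  "gens = (\<Union>a\<in>{a. algebraic a}. \<Union>b\<in>{b. algebraic b}.
     {PX a ^ 2 + PY a ^ 2 - 1,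
      PX (a + b) - PX a * PX b + PY a * PY b,
      PY (a + b) - PY a * PX b - PX a * PY b})"

text \<open>The ideal of a ring R (given as a subset closed under the ring operations) generated
  by a set G: all finite R-linear combinations of elements of G.\<close>
inductive_set gen_ideal :: "mpoly set \<Rightarrow> mpoly set \<Rightarrow> mpoly set" for R G where
  zero: "0 \<in> gen_ideal R G"
| step: "p \<in> gen_ideal R G \<Longrightarrow> r \<in> R \<Longrightarrow> g \<in> G \<Longrightarrow> p + r * g \<in> gen_ideal R G"

end

(*
  Modulo the ideal, the elements e(a) = X_a + i Y_a satisfy e(0) = 1 and e(a + b) = e(a) e(b), and
  X_a, Y_a are linear combinations of e(a) and e(-a). Hence every element of the polynomial ring is
  congruent to a linear combination of finitely many e(a) with algebraic coefficients. Since ev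
  maps e(a) to exp(i a), such a combination in the kernel vanishes by Lindemann-Weierstrass.

  The Lindemann-Weierstrass theorem is proved without Galois theory. Given a relation
  sum c_a exp(a) = 0, scale all exponents and coefficients into the root set A of a monic integer
  polynomial with simple nonzero roots, and let G be the product of the power series
  sum pi(c_a) exp(pi(a) X) over all permutations pi of A. It is nonzero and vanishes at X = 1, and
  its coefficients u_m / m! are symmetric in A, so that the u_m are rational with denominators of
  exponential size. Put v_m = m! (u_0/0! + ... + u_m/m!) and let L and U be the linear functionals
  on polynomials that send x^m to v_m and u_m. As sum u_m / m! = 0, the v_m grow only
  exponentially, whereas L(T^n x^k) is n! times a rational with denominator of exponential size if
  T is an integer polynomial vanishing at all exponents of G. So L(T^n x^k) = 0 for large n, that
  is, L kills a nonzero ideal. The identity L(f') = L(f) - U(f) makes the largest such ideal nearly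
  closed under derivatives, which forces it to be the unit ideal. Hence L = 0, so U = 0 and G = 0,
  a contradiction.
*)
theory Submission
  imports
    Defs
    "HOL-Computational_Algebra.Computational_Algebra"
    "HOL-Computational_Algebra.Field_as_Ring"
    "HOL-Combinatorics.Permutations"
    "HOL-Analysis.Complex_Transcendental"
begin

subsection \<open>Integer polynomials and coefficientwise absolute values\<close>

definition int_poly :: "complex poly \<Rightarrow> bool" where
  "int_poly p \<longleftrightarrow> (\<forall>i. coeff p i \<in> \<int>)"

lemma int_poly_mult: "int_poly p \<Longrightarrow> int_poly q \<Longrightarrow> int_poly (p * q)"
  by (auto simp: int_poly_def coeff_mult)

lemma int_poly_monom: "int_poly (monom 1 k)"
  by (simp add: int_poly_def)

lemma int_poly_power: "int_poly p \<Longrightarrow> int_poly (p ^ n)"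
  by (induction n) (use int_poly_mult in \<open>auto simp: int_poly_def\<close>)

text \<open>The \<open>j\<close>-th derivative of x^(i+j) is j! times the binomial coefficient (i+j
  choose j) times x^i. This is the source of the factorials that later absorb
  \<open>fact n\<close>.\<close>

lemma higher_pderiv_int_poly:
  assumes "int_poly p"
  obtains q where "int_poly q" "degree q \<le> degree p" "(pderiv ^^ j) p = smult (fact j) q"
proof
  define q where "q = smult (inverse (fact j)) ((pderiv ^^ j) p)"
  show "(pderiv ^^ j) p = smult (fact j) q"
    by (simp add: q_def)
  show "degree q \<le> degree p"
    by (simp add: q_def degree_higher_pderiv)
  have "coeff q i \<in> \<int>" for i
  proof -
    have "pochhammer (of_nat (Suc i)) j = (fact j * of_nat ((i + j) choose j) :: complex)"
      by (simp add: gbinomial_pochhammer' binomial_gbinomial algebra_simps)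
    then have "coeff q i = of_nat ((i + j) choose j) * coeff p (i + j)"
      by (simp add: q_def coeff_higher_pderiv)
    then show ?thesis
      using assms by (auto simp: int_poly_def)
  qed
  then show "int_poly q"
    by (simp add: int_poly_def)
qed

text \<open>Each differentiation costs at most one factor \<open>p\<close>, so derivatives of order
  below \<open>n\<close> still vanish at the roots of \<open>p\<close>.\<close>

lemma power_dvd_higher_pderiv:
  fixes p :: "complex poly"
  assumes "i \<le> n"
  shows "p ^ (n - i) dvd (pderiv ^^ i) (p ^ n * q)"
  using assms
proof (induction i)
  case (Suc i)
  then obtain r where r: "(pderiv ^^ i) (p ^ n * q) = p ^ Suc (n - Suc i) * r"
    by (metis Suc_diff_Suc Suc_leD Suc_le_lessD dvdE)
  show ?case
    by (simp add: r pderiv_mult pderiv_power_Suc del: power_Suc) (intro dvd_add dvd_smult; simp)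
qed simp

text \<open>A weighted l1 norm of the coefficients. For nonnegative \<open>r\<close> it is
  submultiplicative, and it dominates any linear functional whose value on x^m is O(r^m).\<close>

definition abs_eval :: "real \<Rightarrow> complex poly \<Rightarrow> real" where
  "abs_eval r p = (\<Sum>m\<le>degree p. norm (coeff p m) * r ^ m)"

lemma sum_coeff_atMost:
  fixes p :: "'a::zero poly" and h :: "nat \<Rightarrow> 'a \<Rightarrow> 'b::comm_monoid_add"
  assumes "degree p \<le> M" "\<And>m. h m 0 = 0"
  shows "(\<Sum>m\<le>M. h m (coeff p m)) = (\<Sum>m\<le>degree p. h m (coeff p m))"
  by (rule sum.mono_neutral_right) (use assms in \<open>auto simp: coeff_eq_0\<close>)

lemma abs_eval_atMost:
  "degree p \<le> M \<Longrightarrow> abs_eval r p = (\<Sum>m\<le>M. norm (coeff p m) * r ^ m)"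
  unfolding abs_eval_def by (rule sum_coeff_atMost[symmetric, where h = "\<lambda>m c. norm c * r ^ m"]) auto

lemma abs_eval_pCons: "abs_eval r (pCons a p) = norm a + r * abs_eval r p"
proof -
  have "abs_eval r (pCons a p) = (\<Sum>m\<le>Suc (degree p). norm (coeff (pCons a p) m) * r ^ m)"
    by (rule abs_eval_atMost) (simp add: degree_pCons_le)
  then show ?thesis
    by (simp add: sum.atMost_Suc_shift abs_eval_def sum_distrib_left mult_ac del: sum.atMost_Suc degree_pCons_eq_if)
qed

lemma abs_eval_add_le: "0 \<le> r \<Longrightarrow> abs_eval r (p + q) \<le> abs_eval r p + abs_eval r q"
  by (simp add: abs_eval_atMost[where M = "max (degree p) (degree q)"] degree_add_le_max
      sum.distrib[symmetric] distrib_right[symmetric])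
     (intro sum_mono mult_right_mono, auto intro: norm_triangle_ineq)

lemma abs_eval_smult: "abs_eval r (smult c p) = norm c * abs_eval r p"
  by (simp add: abs_eval_atMost[where M = "degree p"] sum_distrib_left norm_mult mult_ac)

lemma abs_eval_nonneg: "0 \<le> r \<Longrightarrow> 0 \<le> abs_eval r p"
  by (simp add: abs_eval_def sum_nonneg)

lemma abs_eval_mult_le:
  assumes "0 \<le> r"
  shows "abs_eval r (p * q) \<le> abs_eval r p * abs_eval r q"
proof (induction p rule: pCons_induct)
  case 0
  then show ?case by (simp add: abs_eval_def)
next
  case (pCons a p)
  have "abs_eval r (pCons a p * q) \<le> abs_eval r (smult a q) + abs_eval r (pCons 0 (p * q))"
    using abs_eval_add_le[OF assms] by simp
  also have "\<dots> \<le> norm a * abs_eval r q + r * (abs_eval r p * abs_eval r q)"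
    using pCons assms by (simp add: abs_eval_smult abs_eval_pCons mult_left_mono)
  finally show ?case
    by (simp add: abs_eval_pCons algebra_simps)
qed

lemma abs_eval_power_monom_le:
  assumes "0 \<le> r"
  shows "abs_eval r (p ^ n * monom 1 k) \<le> abs_eval r p ^ n * r ^ k"
proof (induction n)
  case 0
  have "abs_eval r (monom 1 k) = r ^ k"
    by (simp add: abs_eval_def degree_monom_eq if_distrib[of norm] if_distrib[of "\<lambda>x. x * _"] cong: if_cong)
  then show ?case by simp
next
  case (Suc n)
  have "abs_eval r (p ^ Suc n * monom 1 k) \<le> abs_eval r p * abs_eval r (p ^ n * monom 1 k)"
    using abs_eval_mult_le[OF assms] by (simp add: mult.assoc)
  also have "\<dots> \<le> abs_eval r p * (abs_eval r p ^ n * r ^ k)"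
    by (intro mult_left_mono Suc abs_eval_nonneg assms)
  finally show ?case by (simp add: mult_ac)
qed

text \<open>Since n! m! \<le> (n+m+1)!, the tail of the series is dominated by |z|^(m+1) times the
  exponential series at \<open>norm z\<close>.\<close>

lemma norm_exp_remainder_le:
  fixes z :: complex
  shows "norm (fact m * (exp z - (\<Sum>i\<le>m. z ^ i / fact i))) \<le> norm z ^ Suc m * exp (norm z)"
proof -
  have ex: "exp z = suminf (\<lambda>n. z ^ n / fact n)"
    by (simp add: exp_def scaleR_conv_of_real field_simps)
  have sm: "summable (\<lambda>n. z ^ n / fact n)"
    using summable_exp_generic[of z] by (simp add: scaleR_conv_of_real field_simps)
  have "exp z - (\<Sum>i\<le>m. z ^ i / fact i) = suminf (\<lambda>n. z ^ (n + Suc m) / fact (n + Suc m))"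
    unfolding ex lessThan_Suc_atMost[symmetric]
    using suminf_minus_initial_segment[OF sm, of "Suc m"] by simp
  then have eq: "fact m * (exp z - (\<Sum>i\<le>m. z ^ i / fact i))
      = suminf (\<lambda>n. fact m * (z ^ (n + Suc m) / fact (n + Suc m)))"
    using suminf_mult[OF summable_ignore_initial_segment[OF sm, of "Suc m"], of "fact m"] by simp
  have le: "norm (fact m * (z ^ (n + Suc m) / fact (n + Suc m)))
      \<le> norm z ^ Suc m * (norm z ^ n /\<^sub>R fact n)" for n
  proof -
    have "fact n * fact m \<le> (fact (n + Suc m) :: nat)"
      using dvd_imp_le[OF fact_fact_dvd_fact[of n m, where 'a = nat]]
        fact_mono_nat[of "n + m" "n + Suc m"] by simp
    then have "fact n * fact m \<le> (fact (n + Suc m) :: real)"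
      by (metis of_nat_fact of_nat_le_iff of_nat_mult)
    then have "fact m / fact (n + Suc m) \<le> (1 / fact n :: real)"
      by (simp add: field_simps del: fact_Suc)
    then have "fact m / fact (n + Suc m) * norm z ^ (n + Suc m) \<le> 1 / fact n * norm z ^ (n + Suc m)"
      by (intro mult_right_mono) auto
    then show ?thesis
      by (simp add: norm_mult norm_divide norm_power power_add field_simps del: fact_Suc)
  qed
  have sm': "summable (\<lambda>n. norm z ^ Suc m * (norm z ^ n /\<^sub>R fact n))"
    by (intro summable_mult summable_exp_generic)
  have "norm (suminf (\<lambda>n. fact m * (z ^ (n + Suc m) / fact (n + Suc m))))
      \<le> suminf (\<lambda>n. norm z ^ Suc m * (norm z ^ n /\<^sub>R fact n))"
    using le sm' by (rule norm_suminf_le)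
  also have "\<dots> = norm z ^ Suc m * exp (norm z)"
    using summable_exp_generic[of "norm z"] by (simp only: suminf_mult exp_def)
  finally show ?thesis
    by (simp only: eq)
qed

subsection \<open>Vanishing exponential sums\<close>

text \<open>The exponents \<open>g j\<close> may coincide, as happens when a product of exponential
  sums is indexed by choice functions. The final conclusion therefore concerns \<open>u\<close>, the
  Taylor coefficients of the sum of b_j exp(g_j X) multiplied by factorials, instead of the single
  \<open>b j\<close>.\<close>

locale exp_sum =
  fixes J :: "'j set" and b g :: "'j \<Rightarrow> complex"
  assumes finite_J: "finite J"
begin

definition u :: "nat \<Rightarrow> complex" where
  "u m = (\<Sum>j\<in>J. b j * g j ^ m)"

definition v :: "nat \<Rightarrow> complex" where
  "v m = (\<Sum>j\<in>J. b j * (fact m * (\<Sum>i\<le>m. g j ^ i / fact i)))"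

definition U :: "complex poly \<Rightarrow> complex" where
  "U f = (\<Sum>j\<in>J. b j * poly f (g j))"

definition L :: "complex poly \<Rightarrow> complex" where
  "L f = (\<Sum>m\<le>degree f. coeff f m * v m)"

section \<open>Recurrence and derivative identity for the two functionals\<close>

lemma v_0: "v 0 = u 0"
  by (simp add: v_def u_def)

lemma v_Suc: "v (Suc m) = of_nat (Suc m) * v m + u (Suc m)"
  by (simp add: v_def u_def sum_distrib_left sum.distrib[symmetric] algebra_simps del: of_nat_Suc)

lemma U_eq: "degree f \<le> M \<Longrightarrow> U f = (\<Sum>m\<le>M. coeff f m * u m)"
proof -
  assume "degree f \<le> M"
  then have "(\<Sum>m\<le>M. coeff f m * u m) = (\<Sum>m\<le>degree f. coeff f m * u m)"
    by (rule sum_coeff_atMost[where h = "\<lambda>m c. c * u m"]) simp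
  also have "\<dots> = (\<Sum>j\<in>J. \<Sum>m\<le>degree f. coeff f m * (b j * g j ^ m))"
    unfolding u_def sum_distrib_left by (rule sum.swap)
  finally show ?thesis
    by (simp add: U_def poly_altdef sum_distrib_left mult_ac)
qed

lemma U_smult: "U (smult c f) = c * U f"
  by (simp add: U_def sum_distrib_left mult.left_commute)

lemma L_eq: "degree f \<le> M \<Longrightarrow> L f = (\<Sum>m\<le>M. coeff f m * v m)"
  unfolding L_def by (rule sum_coeff_atMost[symmetric, where h = "\<lambda>m c. c * v m"]) auto

lemma L_0 [simp]: "L 0 = 0"
  by (simp add: L_def)

lemma L_add: "L (f + h) = L f + L h"
  by (simp add: L_eq[where M = "max (degree f) (degree h)"] degree_add_le_max
      sum.distrib[symmetric] distrib_right)

lemma L_smult: "L (smult c f) = c * L f"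
  by (simp add: L_eq[where M = "degree f"] sum_distrib_left mult_ac)

lemma L_sum: "L (\<Sum>x\<in>X. f x) = (\<Sum>x\<in>X. L (f x))"
  by (induction X rule: infinite_finite_induct) (auto simp: L_add)

text \<open>On x^(m+1) this is the recurrence \<open>v_Suc\<close>, on 1 it is \<open>v_0\<close>;
  linearity does the rest.\<close>

lemma L_pderiv: "L f = U f + L (pderiv f)"
proof -
  define M where "M = degree f"
  \<comment> \<open>The sum runs up to \<open>M\<close> to match the two below; its last term is
    zero because \<open>coeff f (Suc M) = 0\<close>.\<close>
  have "L (pderiv f) = (\<Sum>m\<le>M. of_nat (Suc m) * coeff f (Suc m) * v m)"
    by (simp add: L_eq[where M = M] degree_pderiv M_def coeff_pderiv)
  moreover have "L f = coeff f 0 * v 0 + (\<Sum>m\<le>M. coeff f (Suc m) * v (Suc m))"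
    by (subst L_eq[where M = "Suc M"]) (simp_all add: M_def sum.atMost_Suc_shift del: sum.atMost_Suc)
  moreover have "U f = coeff f 0 * u 0 + (\<Sum>m\<le>M. coeff f (Suc m) * u (Suc m))"
    by (subst U_eq[where M = "Suc M"]) (simp_all add: M_def sum.atMost_Suc_shift del: sum.atMost_Suc)
  ultimately show ?thesis
    by (simp add: v_0 v_Suc sum.distrib[symmetric] algebra_simps del: of_nat_Suc)
qed

lemma L_higher_pderiv: "L f = (\<Sum>i<n. U ((pderiv ^^ i) f)) + L ((pderiv ^^ n) f)"
proof (induction n)
  case (Suc n)
  then show ?case
    using L_pderiv[of "(pderiv ^^ n) f"] by simp
qed simp

text \<open>Iterating \<open>L_pderiv\<close> until the derivative is zero turns \<open>L f\<close>
  into finitely many values of derivatives at the exponents, to which divisibility arguments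
  apply.\<close>

lemma L_eq_sum_U: "L f = (\<Sum>i\<le>degree f. U ((pderiv ^^ i) f))"
proof -
  have "(pderiv ^^ Suc (degree f)) f = 0"
    by (rule poly_eqI) (simp only: coeff_higher_pderiv, simp add: coeff_eq_0)
  then show ?thesis
    using L_higher_pderiv[of f "Suc (degree f)"] by (simp only: lessThan_Suc_atMost) simp
qed

text \<open>As the full sum vanishes, \<open>- v m\<close> is m! times a combination of remainders
  of exponential series; the factorial cancels and geometric growth remains.\<close>

lemma norm_v_le:
  assumes "(\<Sum>j\<in>J. b j * exp (g j)) = 0"
  obtains K r where "0 \<le> K" "1 \<le> r" "\<And>m. norm (v m) \<le> K * r ^ m"
proof
  \<comment> \<open>The summand 1 ensures 1 \<le> r, and \<open>r\<close> bounds the norm of every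
    exponent. The factor \<open>r\<close> in \<open>K\<close> absorbs the extra power in
    \<open>r ^ Suc m\<close>.\<close>
  define r where "r = 1 + (\<Sum>j\<in>J. norm (g j))"
  define K where "K = r * (\<Sum>j\<in>J. norm (b j) * exp (norm (g j)))"
  show r: "1 \<le> r"
    by (simp add: r_def sum_nonneg)
  show "0 \<le> K"
    using r by (simp add: K_def sum_nonneg)
  have gr: "norm (g j) \<le> r" if "j \<in> J" for j
    using member_le_sum[of j J "\<lambda>j. norm (g j)"] that finite_J by (auto simp: r_def)
  show "norm (v m) \<le> K * r ^ m" for m
  proof -
    have *: "a * (x * y) - x * (a * z) = x * (a * (y - z))" for a x y z :: complex
      by (simp add: right_diff_distrib mult.left_commute)
    have "- v m = fact m * (\<Sum>j\<in>J. b j * exp (g j)) - v m"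
      using assms by simp
    also have "\<dots> = (\<Sum>j\<in>J. fact m * (b j * exp (g j)) - b j * (fact m * (\<Sum>i\<le>m. g j ^ i / fact i)))"
      by (simp only: v_def sum_subtractf sum_distrib_left[where A = J])
    also have "\<dots> = (\<Sum>j\<in>J. b j * (fact m * (exp (g j) - (\<Sum>i\<le>m. g j ^ i / fact i))))"
      by (rule sum.cong[OF refl]) (rule *)
    finally have "norm (v m) = norm (\<Sum>j\<in>J. b j * (fact m * (exp (g j) - (\<Sum>i\<le>m. g j ^ i / fact i))))"
      using norm_minus_cancel[of "v m"] by (simp only:)
    also have "\<dots> \<le> (\<Sum>j\<in>J. norm (b j * (fact m * (exp (g j) - (\<Sum>i\<le>m. g j ^ i / fact i)))))"
      by (rule norm_sum)
    also have "\<dots> \<le> (\<Sum>j\<in>J. norm (b j) * (r ^ Suc m * exp (norm (g j))))"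
    proof (rule sum_mono)
      fix j assume j: "j \<in> J"
      have "norm (g j) ^ Suc m * exp (norm (g j)) \<le> r ^ Suc m * exp (norm (g j))"
        by (intro mult_right_mono power_mono gr j) auto
      then show "norm (b j * (fact m * (exp (g j) - (\<Sum>i\<le>m. g j ^ i / fact i))))
          \<le> norm (b j) * (r ^ Suc m * exp (norm (g j)))"
        unfolding norm_mult[of "b j"]
        by (intro mult_left_mono order_trans[OF norm_exp_remainder_le]) auto
    qed
    also have "\<dots> = (\<Sum>j\<in>J. norm (b j) * exp (norm (g j))) * r ^ Suc m"
      unfolding sum_distrib_right by (rule sum.cong[OF refl]) (simp only: mult_ac)
    also have "\<dots> = K * r ^ m"
      by (simp add: K_def mult_ac)
    finally show ?thesis .
  qed
qed

text \<open>In \<open>L_eq_sum_U\<close>, derivatives of order below \<open>n\<close> contribute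
  nothing because \<open>T\<close> still divides them, and those of order i \<ge> n carry i!, a
  multiple of n!. The exponent of \<open>D\<close> bounds the degree, hence the index of every
  \<open>u m\<close> involved.\<close>

lemma L_power_monom_Ints:
  assumes T: "int_poly T" "\<And>j. j \<in> J \<Longrightarrow> poly T (g j) = 0"
    and N: "\<And>m. of_int N * of_nat D ^ m * u m \<in> \<int>"
  shows "of_int N * of_nat D ^ (n * degree T + k) * (L (T ^ n * monom 1 k) / fact n) \<in> \<int>"
proof -
  define f where "f = T ^ n * monom 1 k"
  define M where "M = n * degree T + k"
  have f: "int_poly f" "degree f \<le> M"
  proof -
    show "int_poly f"
      by (simp add: f_def int_poly_mult int_poly_monom int_poly_power T(1))
    have "degree f \<le> degree (T ^ n) + degree (monom (1 :: complex) k)"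
      unfolding f_def by (rule degree_mult_le)
    also have "\<dots> \<le> M"
      using degree_power_le[of T n] by (simp add: M_def degree_monom_eq mult.commute)
    finally show "degree f \<le> M" .
  qed
  \<comment> \<open>\<open>D ^ M\<close> clears all \<open>u m\<close> with m \<le> M at once, as
    the surplus \<open>D ^ (M - m)\<close> is an integer.\<close>
  have U_int: "of_int N * of_nat D ^ M * U q \<in> \<int>" if "int_poly q" "degree q \<le> M" for q
  proof -
    have "of_int N * of_nat D ^ M * U q
        = (\<Sum>m\<le>M. coeff q m * of_nat D ^ (M - m) * (of_int N * of_nat D ^ m * u m))"
      unfolding U_eq[OF that(2)] sum_distrib_left
    proof (rule sum.cong[OF refl])
      fix m assume "m \<in> {..M}"
      then have "(of_nat D :: complex) ^ M = of_nat D ^ (M - m) * of_nat D ^ m"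
        by (simp flip: power_add)
      then show "of_int N * of_nat D ^ M * (coeff q m * u m)
          = coeff q m * of_nat D ^ (M - m) * (of_int N * of_nat D ^ m * u m)"
        by (simp only: mult_ac)
    qed
    also have "\<dots> \<in> \<int>"
      by (rule Ints_sum, rule Ints_mult[OF _ N]) (use that(1) in \<open>auto simp: int_poly_def\<close>)
    finally show ?thesis .
  qed
  have "of_int N * of_nat D ^ M * (U ((pderiv ^^ i) f) / fact n) \<in> \<int>" for i
  proof (cases "i < n")
    case True
    have "poly ((pderiv ^^ i) f) (g j) = 0" if "j \<in> J" for j
    proof -
      have "T dvd T ^ (n - i)"
        using True by (simp add: dvd_power)
      then have "T dvd (pderiv ^^ i) f"
        using power_dvd_higher_pderiv[of i n T "monom 1 k"] True dvd_trans unfolding f_def by auto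
      then show ?thesis
        using T(2)[OF that] by (auto elim: dvdE)
    qed
    then show ?thesis
      by (simp add: U_def)
  next
    case False
    obtain q where q: "int_poly q" "degree q \<le> degree f" "(pderiv ^^ i) f = smult (fact i) q"
      using higher_pderiv_int_poly[OF f(1)] by blast
    have "fact n dvd (fact i :: int)"
      using False by (intro fact_dvd) simp
    then obtain c where "fact i = fact n * (c :: int)" ..
    then have "fact i = fact n * (of_int c :: complex)"
      by (metis of_int_fact of_int_mult)
    then have "of_int N * of_nat D ^ M * (U ((pderiv ^^ i) f) / fact n)
        = of_int c * (of_int N * of_nat D ^ M * U q)"
      by (simp add: q(3) U_smult)
    also have "\<dots> \<in> \<int>"
      by (rule Ints_mult[OF Ints_of_int U_int[OF q(1)]]) (use q(2) f(2) in simp)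
    finally show ?thesis .
  qed
  then show ?thesis
    unfolding f_def[symmetric] M_def[symmetric]
    unfolding L_eq_sum_U[of f] sum_divide_distrib sum_distrib_left by (rule Ints_sum)
qed

text \<open>With denominators cleared, \<open>L (T ^ n * monom 1 k) / fact n\<close> is an integer
  bounded by an exponential in \<open>n\<close> over n!, hence 0 for large \<open>n\<close>. The
  restriction on \<open>k\<close> makes the threshold uniform in \<open>k\<close>.\<close>

lemma L_power_monom_eventually_0:
  assumes S: "(\<Sum>j\<in>J. b j * exp (g j)) = 0"
    and T: "int_poly T" "\<And>j. j \<in> J \<Longrightarrow> poly T (g j) = 0"
    and N: "\<And>m. of_int N * of_nat D ^ m * u m \<in> \<int>" "N \<noteq> 0" "D > 0"
  obtains n0 where "\<And>n k. n \<ge> n0 \<Longrightarrow> k < degree T \<Longrightarrow> L (T ^ n * monom 1 k) = 0"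
proof -
  obtain K r where K: "0 \<le> K" "1 \<le> r" "\<And>m. norm (v m) \<le> K * r ^ m"
    using norm_v_le[OF S] by blast
  have L_le: "norm (L f) \<le> K * abs_eval r f" for f
  proof -
    have "norm (L f) \<le> (\<Sum>m\<le>degree f. norm (coeff f m * v m))"
      unfolding L_def by (rule norm_sum)
    also have "\<dots> \<le> (\<Sum>m\<le>degree f. norm (coeff f m) * (K * r ^ m))"
      unfolding norm_mult by (intro sum_mono mult_left_mono K) auto
    finally show ?thesis
      by (simp add: abs_eval_def sum_distrib_left mult_ac)
  qed
  define d where "d = degree T"
  \<comment> \<open>\<open>B\<close> is the growth per unit of \<open>n\<close>; \<open>C\<close>
    collects the rest, with the exponent \<open>k\<close> enlarged to \<open>d\<close>.\<close>
  define C where "C = \<bar>of_int N\<bar> * K * (of_nat D * r) ^ d"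
  define B where "B = of_nat D ^ d * abs_eval r T"
  have "(\<lambda>n. B ^ n /\<^sub>R fact n) \<longlonglongrightarrow> 0"
    by (rule summable_LIMSEQ_zero) (rule summable_exp_generic)
  then have "(\<lambda>n. C * (B ^ n /\<^sub>R fact n)) \<longlonglongrightarrow> 0"
    by (rule tendsto_mult_right_zero)
  then have "eventually (\<lambda>n. C * (B ^ n /\<^sub>R fact n) < 1) sequentially"
    by (rule order_tendstoD) simp
  then obtain n0 where n0: "\<And>n. n \<ge> n0 \<Longrightarrow> C * (B ^ n /\<^sub>R fact n) < 1"
    by (auto simp: eventually_sequentially)
  show thesis
  proof (rule that)
    fix n k assume n: "n \<ge> n0" and k: "k < degree T"
    define z where "z = of_int N * of_nat D ^ (n * d + k) * (L (T ^ n * monom 1 k) / fact n)"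
    have "norm (L (T ^ n * monom 1 k)) \<le> K * (abs_eval r T ^ n * r ^ k)"
      using L_le[of "T ^ n * monom 1 k"] abs_eval_power_monom_le[of r T n k] K(1,2)
      by (meson mult_left_mono order_trans zero_le_one)
    then have "norm z \<le> \<bar>of_int N\<bar> * of_nat D ^ (n * d + k) * (K * (abs_eval r T ^ n * r ^ k) / fact n)"
      unfolding z_def norm_mult norm_divide norm_power norm_of_int norm_of_nat norm_fact
      by (intro mult_left_mono divide_right_mono) auto
    also have "\<dots> = (\<bar>of_int N\<bar> * K * (B ^ n /\<^sub>R fact n)) * (of_nat D * r) ^ k"
      by (simp add: B_def power_mult_distrib power_add power_mult mult.commute[of n d] field_simps)
    also have "\<dots> \<le> (\<bar>of_int N\<bar> * K * (B ^ n /\<^sub>R fact n)) * (of_nat D * r) ^ d"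
    proof (rule mult_left_mono)
      have "1 * 1 \<le> of_nat D * r"
        by (intro mult_mono) (use N(3) K(2) in auto)
      then show "(of_nat D * r) ^ k \<le> (of_nat D * r) ^ d"
        using k by (intro power_increasing) (auto simp: d_def)
      show "0 \<le> \<bar>of_int N\<bar> * K * (B ^ n /\<^sub>R fact n)"
        using K by (auto simp: B_def intro!: mult_nonneg_nonneg abs_eval_nonneg zero_le_power)
    qed
    also have "\<dots> = C * (B ^ n /\<^sub>R fact n)"
      by (simp add: C_def)
    also have "\<dots> < 1"
      using n by (rule n0)
    finally have "norm z < 1" .
    moreover have "z \<in> \<int>"
      unfolding z_def d_def by (rule L_power_monom_Ints[OF T N(1)])
    ultimately have "z = 0"
      by (auto elim!: Ints_cases)
    then show "L (T ^ n * monom 1 k) = 0"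
      using N(2,3) by (simp add: z_def)
  qed
qed

text \<open>Division of \<open>f\<close> by \<open>T\<close> with remainder: the quotient has
  smaller degree and gains a factor \<open>T\<close>, so the induction must allow \<open>n\<close>
  to grow; the remainder is covered by the hypothesis on monomials.\<close>

lemma L_power_mult_0:
  assumes "degree T > 0" "\<And>n k. n \<ge> n0 \<Longrightarrow> k < degree T \<Longrightarrow> L (T ^ n * monom 1 k) = 0"
    and "n \<ge> n0"
  shows "L (T ^ n * f) = 0"
  using \<open>n \<ge> n0\<close>
proof (induction "degree f" arbitrary: f n rule: less_induct)
  case less
  have small: "L (T ^ n * h) = 0" if "degree h < degree T" for h
  proof -
    have "T ^ n * h = (\<Sum>k\<le>degree h. smult (coeff h k) (T ^ n * monom 1 k))"
      by (subst poly_as_sum_of_monoms[of h, symmetric])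
         (simp add: sum_distrib_left smult_monom flip: mult_smult_right)
    then show ?thesis
      using assms(2) less.prems that by (simp add: L_sum L_smult)
  qed
  show ?case
  proof (cases "degree f < degree T")
    case False
    have "T \<noteq> 0"
      using assms(1) by auto
    have "degree (f div T) < degree f"
      using False assms(1) degree_div_less[of f T] \<open>T \<noteq> 0\<close>
      by (metis degree_0 le_zero_eq not_gr_zero not_le_imp_less)
    then have "L (T ^ Suc n * (f div T)) = 0"
      using less.prems by (intro less.hyps) auto
    moreover have "degree (f mod T) < degree T"
      using assms(1) degree_mod_less[OF \<open>T \<noteq> 0\<close>, of f] by auto
    moreover have "T ^ n * f = T ^ Suc n * (f div T) + T ^ n * (f mod T)"
      using arg_cong[OF mult_div_mod_eq[of T f], of "\<lambda>h. T ^ n * h"]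
      by (simp only: distrib_left power_Suc mult_ac)
    ultimately show ?thesis
      by (simp add: L_add small)
  qed (use small in auto)
qed

text \<open>The largest ideal inside the kernel of \<open>L\<close> is nonzero, hence generated by
  some \<open>P\<close>. It turns out that \<open>P\<close> divides its derivative, so
  \<open>P\<close> is constant, and \<open>L\<close> and \<open>U\<close> vanish.\<close>

theorem u_eq_0:
  assumes S: "(\<Sum>j\<in>J. b j * exp (g j)) = 0"
    and T: "int_poly T" "T \<noteq> 0" "\<And>j. j \<in> J \<Longrightarrow> poly T (g j) = 0"
    and N: "\<And>m. of_int N * of_nat D ^ m * u m \<in> \<int>" "N \<noteq> 0" "D > 0"
  shows "u m = 0"
proof -
  define I where "I = {f. \<forall>h. L (f * h) = 0}"
  have I_add: "f + h \<in> I" if "f \<in> I" "h \<in> I" for f h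
    using that by (simp add: I_def distrib_right L_add)
  have I_mult: "f * h \<in> I" if "f \<in> I" for f h
    using that by (simp add: I_def mult.assoc)
  \<comment> \<open>If \<open>f\<close> vanishes at all exponents, then U(f h) = 0 and so L((f h)')
    = L(f h) = 0; the product rule isolates L(f' h).\<close>
  have I_pderiv: "pderiv f \<in> I" if "f \<in> I" "\<And>j. j \<in> J \<Longrightarrow> poly f (g j) = 0" for f
  proof -
    have "L (pderiv f * h) = 0" for h
    proof -
      have "U (f * h) = 0"
        using that(2) by (simp add: U_def)
      then have "L (pderiv (f * h)) = 0"
        using L_pderiv[of "f * h"] that(1) by (simp add: I_def)
      moreover have "L (pderiv (f * h)) = L (f * pderiv h) + L (pderiv f * h)"
        by (simp add: pderiv_mult L_add mult.commute)
      ultimately show ?thesis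
        using that(1) by (simp add: I_def)
    qed
    then show ?thesis
      by (simp add: I_def)
  qed
  \<comment> \<open>The factor x ensures positive degree, as division with remainder requires;
    \<open>T\<close> may be constant when \<open>J\<close> is empty.\<close>
  define T' where "T' = T * monom 1 1"
  have T': "int_poly T'" "degree T' > 0" "\<And>j. j \<in> J \<Longrightarrow> poly T' (g j) = 0" "T' \<noteq> 0"
    using T by (auto simp: T'_def int_poly_mult int_poly_monom degree_mult_eq degree_monom_eq)
  obtain n0 where n0: "\<And>n k. n \<ge> n0 \<Longrightarrow> k < degree T' \<Longrightarrow> L (T' ^ n * monom 1 k) = 0"
    using L_power_monom_eventually_0[OF S T'(1,3) N] by blast
  have "T' ^ n0 \<in> I"
    using L_power_mult_0[OF T'(2) n0] by (simp add: I_def)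
  moreover have "T' ^ n0 \<noteq> 0"
    using T' by simp
  \<comment> \<open>A nonzero element of least degree generates the ideal.\<close>
  ultimately obtain P where P: "P \<in> I" "P \<noteq> 0" and min: "\<And>f. f \<in> I \<Longrightarrow> f \<noteq> 0 \<Longrightarrow> degree P \<le> degree f"
    using ex_has_least_nat[of "\<lambda>f. f \<in> I \<and> f \<noteq> 0" "T' ^ n0" degree] by blast
  have P_dvd: "P dvd f" if "f \<in> I" for f
  proof -
    have "f mod P = f + P * (- (f div P))"
      by (simp add: minus_mult_div_eq_mod[symmetric])
    then have "f mod P \<in> I"
      using I_add I_mult P(1) that by metis
    then have "f mod P = 0"
      using min[of "f mod P"] degree_mod_less[OF P(2), of f] by fastforce
    then show ?thesis
      by auto
  qed
  (* P W vanishes at every g j, so (P W)' is in I; its factor W can be stripped as P has no root of W. *)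
  define W where "W = (\<Prod>w\<in>{w \<in> g ` J. poly P w \<noteq> 0}. [:- w, 1:])"
  have "pderiv (P * W) \<in> I"
  proof (rule I_pderiv)
    show "P * W \<in> I"
      using P(1) by (rule I_mult)
    show "poly (P * W) (g j) = 0" if "j \<in> J" for j
      using that finite_J by (auto simp: W_def poly_prod)
  qed
  then have "P dvd P * pderiv W + W * pderiv P"
    using P_dvd by (simp add: pderiv_mult)
  then have dvd_W: "P dvd W * pderiv P"
    by (simp add: dvd_add_right_iff)
  \<comment> \<open>Evaluating (X - w) h = P q at \<open>w\<close>, where P(w) \<noteq> 0, gives
    q(w) = 0, so the factor X - w cancels. The factors are removed one by one.\<close>
  have strip: "P dvd f" if "finite Z" "\<forall>w\<in>Z. poly P w \<noteq> 0" "P dvd (\<Prod>w\<in>Z. [:- w, 1:]) * f" for Z f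
    using that
  proof (induction Z arbitrary: f rule: finite_induct)
    case (insert w Z)
    define h where "h = (\<Prod>w\<in>Z. [:- w, 1:]) * f"
    have "P dvd [:- w, 1:] * h"
      using insert.prems(2) insert.hyps unfolding h_def by (simp only: mult.assoc prod.insert not_False_eq_True)
    then obtain q where q: "[:- w, 1:] * h = P * q" ..
    then have "poly ([:- w, 1:] * h) w = poly (P * q) w"
      by simp
    then have "poly q w = 0"
      using insert.prems by simp
    then obtain q' where "q = [:- w, 1:] * q'"
      by (auto simp: poly_eq_0_iff_dvd elim: dvdE)
    with q have "[:- w, 1:] * h = [:- w, 1:] * (P * q')"
      by (simp only: mult.left_commute)
    then have "h = P * q'"
      using mult_left_cancel[of "[:- w, 1:]" h "P * q'"] by (simp only: pCons_eq_0_iff) simp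
    then have "P dvd (\<Prod>w\<in>Z. [:- w, 1:]) * f"
      by (simp add: h_def)
    then show ?case
      using insert.IH[of f] insert.prems(1) by blast
  qed simp
  have "P dvd pderiv P"
    by (rule strip[OF _ _ dvd_W[unfolded W_def]]) (use finite_J in auto)
  \<comment> \<open>The derivative of a nonconstant \<open>P\<close> is nonzero and of smaller
    degree, so \<open>P\<close> cannot divide it.\<close>
  then have "degree P = 0"
    using dvd_imp_degree_le[of P "pderiv P"] by (cases "pderiv P = 0") (auto simp: degree_pderiv pderiv_eq_0_iff)
  then obtain c where "P = [:c:]" "c \<noteq> 0"
    using P(2) by (metis degree_eq_zeroE pCons_0_0)
  then have [simp]: "L f = 0" for f
    using P(1) by (simp add: I_def L_smult)
  have "U (monom 1 m) = 0"
    using L_pderiv[of "monom 1 m"] by simp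
  then show ?thesis
    by (simp add: U_def u_def poly_monom)
qed

end

subsection \<open>Algebraic numbers\<close>

lemma exists_int_poly:
  assumes "finite X" "\<And>x. x \<in> X \<Longrightarrow> algebraic x"
  obtains p where "int_poly p" "p \<noteq> 0" "\<And>x. x \<in> X \<Longrightarrow> poly p x = 0"
proof -
  have "\<exists>p. int_poly p \<and> p \<noteq> 0 \<and> (\<forall>x\<in>X. poly p x = 0)"
    using assms
  proof (induction X rule: finite_induct)
    case empty
    show ?case
      by (rule exI[of _ 1]) (simp add: int_poly_def)
  next
    case (insert x X)
    then obtain p where p: "int_poly p" "p \<noteq> 0" "\<forall>x\<in>X. poly p x = 0"
      by auto
    moreover obtain q where "int_poly q" "q \<noteq> 0" "poly q x = 0"
      using insert.prems algebraicE[of x] by (auto simp: int_poly_def)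
    ultimately show ?case
      by (intro exI[of _ "q * p"]) (simp add: int_poly_mult)
  qed
  then show ?thesis
    using that by blast
qed

text \<open>The complex numbers form a rational vector space, in which algebraicity becomes a matter
  of finite dimension.\<close>

interpretation rat_space: vector_space "\<lambda>(q::rat) (z::complex). of_rat q * z"
  by standard (simp_all add: algebra_simps of_rat_add of_rat_mult)

text \<open>All powers of \<open>z\<close> lie in the span of \<open>B\<close>, so
  \<open>card B + 1\<close> distinct ones are dependent, and a dependence is a polynomial equation
  for \<open>z\<close>.\<close>

lemma algebraic_if_stable_span:
  assumes "finite B" "1 \<in> rat_space.span B" "\<And>x. x \<in> B \<Longrightarrow> z * x \<in> rat_space.span B"
  shows "algebraic z"
proof -
  have stable: "z * x \<in> rat_space.span B" if "x \<in> rat_space.span B" for x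
    using that
  proof (induction rule: rat_space.span_induct_alt)
    case (step c x y)
    have "z * (of_rat c * x + y) = of_rat c * (z * x) + z * y"
      by (simp add: algebra_simps)
    then show ?case
      using step assms(3) by (auto intro!: rat_space.span_add rat_space.span_scale)
  qed (simp add: rat_space.span_zero)
  have powers: "z ^ n \<in> rat_space.span B" for n
    by (induction n) (simp_all add: assms(2) stable)
  define N where "N = card B"
  show ?thesis
  \<comment> \<open>Dependence is a property of sets, so coinciding powers are treated apart; they
    give the equation x^i - x^j = 0.\<close>
  proof (cases "inj_on (\<lambda>n. z ^ n) {..N}")
    case False
    then obtain i j where ij: "i \<noteq> j" "z ^ i = z ^ j"
      by (auto simp: inj_on_def)
    show ?thesis
    proof (rule algebraicI)
      show "coeff (monom 1 i - monom 1 j) n \<in> \<int>" for n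
        by simp
      show "monom 1 i - monom 1 j \<noteq> (0 :: complex poly)"
        using ij(1) by (auto simp: poly_eq_iff intro!: exI[of _ i])
      show "poly (monom 1 i - monom 1 j) z = 0"
        using ij(2) by (simp add: poly_monom)
    qed
  next
    case True
    define S where "S = (\<lambda>n. z ^ n) ` {..N}"
    have "card S = Suc N"
      unfolding S_def using True by (simp add: card_image)
    moreover have "S \<subseteq> rat_space.span B"
      by (auto simp: S_def powers)
    ultimately have "rat_space.dependent S"
      using rat_space.independent_span_bound[OF assms(1), of S] by (auto simp: N_def)
    then obtain c where c: "\<exists>s\<in>S. c s \<noteq> 0" "(\<Sum>s\<in>S. of_rat (c s) * s) = 0"
      by (subst (asm) rat_space.dependent_finite) (auto simp: S_def)
    define p where "p = (\<Sum>n\<le>N. monom (of_rat (c (z ^ n)) :: complex) n)"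
    have coeff_p: "coeff p n = (if n \<le> N then of_rat (c (z ^ n)) else 0)" for n
      by (simp add: p_def coeff_sum)
    show ?thesis
    proof (rule algebraicI')
      show "coeff p n \<in> \<rat>" for n
        by (simp add: coeff_p)
      obtain n where "n \<le> N" "c (z ^ n) \<noteq> 0"
        using c(1) by (auto simp: S_def)
      then have "coeff p n \<noteq> 0"
        by (simp add: coeff_p)
      then show "p \<noteq> 0"
        by auto
      have "poly p z = (\<Sum>n\<le>N. of_rat (c (z ^ n)) * z ^ n)"
        by (simp add: p_def poly_sum poly_monom)
      also have "\<dots> = (\<Sum>s\<in>S. of_rat (c s) * s)"
        unfolding S_def using True by (simp add: sum.reindex)
      finally show "poly p z = 0"
        using c(2) by simp
    qed
  qed
qed

lemma algebraic_power_in_span: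
  fixes x :: complex
  assumes "algebraic x"
  obtains m where "m > 0" "x ^ m \<in> rat_space.span ((\<lambda>i. x ^ i) ` {..<m})"
proof -
  obtain p where p: "\<And>i. coeff p i \<in> \<rat>" "p \<noteq> 0" "poly p x = 0"
    using assms unfolding algebraic_altdef by blast
  define m where "m = degree p"
  have lc: "coeff p m \<noteq> 0"
    using p(2) by (simp add: m_def)
  have "m > 0"
  proof (rule ccontr)
    assume "\<not> m > 0"
    then have "p = [:coeff p 0:]"
      using degree_0_id[of p] by (simp add: m_def)
    then show False
      using p(2,3) by (metis mult_zero_right add.right_neutral poly_0 poly_pCons pCons_0_0)
  qed
  have "poly p x = (\<Sum>i<m. coeff p i * x ^ i) + coeff p m * x ^ m"
    by (simp add: poly_altdef m_def lessThan_Suc_atMost[symmetric])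
  then have "x ^ m = (\<Sum>i<m. (- coeff p i / coeff p m) * x ^ i)"
    using p(3) lc by (simp add: field_simps sum_divide_distrib[symmetric] sum_negf add_eq_0_iff)
  also have "\<dots> \<in> rat_space.span ((\<lambda>i. x ^ i) ` {..<m})"
  proof (rule rat_space.span_sum)
    fix i assume i: "i \<in> {..<m}"
    have "- coeff p i / coeff p m \<in> \<rat>"
      using p(1) by (intro Rats_divide) auto
    then obtain q where "- coeff p i / coeff p m = of_rat q"
      by (rule Rats_cases)
    then show "- coeff p i / coeff p m * x ^ i \<in> rat_space.span ((\<lambda>i. x ^ i) ` {..<m})"
      using i by (simp only:) (intro rat_space.span_scale rat_space.span_base imageI)
  qed
  finally show ?thesis
    using that \<open>m > 0\<close> by blast
qed

text \<open>The products x^i y^j with i < m and j < n span a space stable under multiplication by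
  \<open>x\<close> and by \<open>y\<close>: an exponent that reaches \<open>m\<close> or
  \<open>n\<close> is rewritten through lower powers. Stability under \<open>x + y\<close> and
  \<open>x * y\<close> follows.\<close>

lemma
  fixes x y :: complex
  assumes "algebraic x" "algebraic y"
  shows algebraic_add: "algebraic (x + y)" and algebraic_mult: "algebraic (x * y)"
proof -
  obtain m where m: "m > 0" "x ^ m \<in> rat_space.span ((\<lambda>i. x ^ i) ` {..<m})"
    using algebraic_power_in_span[OF assms(1)] by blast
  obtain n where n: "n > 0" "y ^ n \<in> rat_space.span ((\<lambda>i. y ^ i) ` {..<n})"
    using algebraic_power_in_span[OF assms(2)] by blast
  define B where "B = (\<lambda>(i, j). x ^ i * y ^ j) ` ({..<m} \<times> {..<n})"
  have B: "x ^ i * y ^ j \<in> rat_space.span B" if "i < m" "j < n" for i j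
    using that by (intro rat_space.span_base) (auto simp: B_def)
  have mult_span: "w * z \<in> rat_space.span B" if "w \<in> rat_space.span W" "\<And>w. w \<in> W \<Longrightarrow> w * z \<in> rat_space.span B"
    for w z W
    using that(1)
  proof (induction rule: rat_space.span_induct_alt)
    case (step c v w)
    have "(of_rat c * v + w) * z = of_rat c * (v * z) + w * z"
      by (simp add: algebra_simps)
    then show ?case
      using step that(2) by (auto intro!: rat_space.span_add rat_space.span_scale)
  qed (simp add: rat_space.span_zero)
  have x_B: "w * x \<in> rat_space.span B" if w: "w \<in> B" for w
  proof -
    obtain i j where ij: "i < m" "j < n" "w = x ^ i * y ^ j"
      using w by (auto simp: B_def)
    show ?thesis
    proof (cases "Suc i < m")
      case True
      then show ?thesis
        using B[of "Suc i" j] ij by (simp add: mult_ac)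
    next
      case False
      then have "m = Suc i"
        using ij(1) by simp
      then have "w * x = x ^ m * y ^ j"
        by (simp add: ij(3) mult_ac)
      also have "\<dots> \<in> rat_space.span B"
        by (rule mult_span[OF m(2)]) (use B ij(2) in auto)
      finally show ?thesis .
    qed
  qed
  have y_B: "w * y \<in> rat_space.span B" if w: "w \<in> B" for w
  proof -
    obtain i j where ij: "i < m" "j < n" "w = x ^ i * y ^ j"
      using w by (auto simp: B_def)
    show ?thesis
    proof (cases "Suc j < n")
      case True
      then show ?thesis
        using B[of i "Suc j"] ij by (simp add: mult_ac)
    next
      case False
      then have "n = Suc j"
        using ij(2) by simp
      then have "w * y = y ^ n * x ^ i"
        by (simp add: ij(3) mult_ac)
      also have "\<dots> \<in> rat_space.span B"
        by (rule mult_span[OF n(2)]) (use B ij(1) in \<open>auto simp: mult.commute[of "y ^ _"]\<close>)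
      finally show ?thesis .
    qed
  qed
  have one: "1 \<in> rat_space.span B"
    using B[of 0 0] m n by simp
  have fin: "finite B"
    by (simp add: B_def)
  show "algebraic (x + y)"
  proof (rule algebraic_if_stable_span[OF fin one])
    show "(x + y) * w \<in> rat_space.span B" if "w \<in> B" for w
      using rat_space.span_add[OF x_B[OF that] y_B[OF that]]
      by (simp only: distrib_right mult.commute[of x w] mult.commute[of y w])
  qed
  show "algebraic (x * y)"
  proof (rule algebraic_if_stable_span[OF fin one])
    fix w assume "w \<in> B"
    then have "w * x * y \<in> rat_space.span B"
      by (rule mult_span[OF x_B y_B])
    then show "x * y * w \<in> rat_space.span B"
      by (simp only: mult.assoc mult.commute[of w "x * y"])
  qed
qed

lemma algebraic_sum: "(\<And>x. x \<in> X \<Longrightarrow> algebraic (f x)) \<Longrightarrow> algebraic (\<Sum>x\<in>X. f x :: complex)"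
  by (induction X rule: infinite_finite_induct) (auto intro: algebraic_add)

subsection \<open>Symmetric functions of the roots of an integer polynomial\<close>

text \<open>Newton's identities without elementary symmetric polynomials. For r_k = sum of a^k Q/(X
  - a), one has r_0 = Q' and r_(k+1) = X r_k - p_k Q, where the power sum p_k is the coefficient of
  r_k in degree \<open>card A - 1\<close>.\<close>

lemma power_sum_Ints:
  assumes "finite A" "int_poly (\<Prod>a\<in>A. [:- a, 1:])"
  shows "(\<Sum>a\<in>A. a ^ k) \<in> \<int>"
proof (cases "A = {}")
  case False
  define Q where "Q = (\<Prod>a\<in>A. [:- a, 1:])"
  define r where "r k = (\<Sum>a\<in>A. smult (a ^ k) (\<Prod>b\<in>A - {a}. [:- b, 1:]))" for k
  have coeff_r: "coeff (r k) (card A - 1) = (\<Sum>a\<in>A. a ^ k)" for k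
  proof -
    have "coeff (\<Prod>b\<in>A - {a}. [:- b, 1:]) (card A - 1) = 1" if "a \<in> A" for a
    proof -
      have "degree (\<Prod>b\<in>A - {a}. [:- b, 1:]) = card A - 1"
        using that assms(1) by (subst degree_prod_sum_eq) auto
      moreover have "lead_coeff (\<Prod>b\<in>A - {a}. [:- b, 1:]) = 1"
        by (simp add: lead_coeff_prod)
      ultimately show ?thesis
        by simp
    qed
    then show ?thesis
      by (simp add: r_def coeff_sum)
  qed
  have "int_poly (r k)" for k
  proof (induction k)
    case 0
    have "r 0 = pderiv Q"
      by (simp add: r_def Q_def pderiv_prod pderiv_pCons)
    then show ?case
      using assms(2) by (simp add: int_poly_def Q_def[symmetric] coeff_pderiv)
  next
    case (Suc k)
    have "r (Suc k) = monom 1 1 * r k - smult (\<Sum>a\<in>A. a ^ k) Q"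
    proof -
      have "smult (a ^ Suc k) (\<Prod>b\<in>A - {a}. [:- b, 1:])
          = monom 1 1 * smult (a ^ k) (\<Prod>b\<in>A - {a}. [:- b, 1:]) - smult (a ^ k) Q" if "a \<in> A" for a
      proof -
        have Q_eq: "Q = [:- a, 1:] * (\<Prod>b\<in>A - {a}. [:- b, 1:])"
          unfolding Q_def using assms(1) that by (rule prod.remove)
        show ?thesis
          unfolding Q_eq by (simp add: monom_Suc monom_0 smult_diff_right mult.commute)
      qed
      then show ?thesis
        by (simp add: r_def sum_distrib_left sum_subtractf smult_sum)
    qed
    moreover have "(\<Sum>a\<in>A. a ^ k) \<in> \<int>"
      using Suc coeff_r[of k] by (metis int_poly_def)
    moreover have "int_poly (monom 1 1 * r k)"
      using Suc by (intro int_poly_mult int_poly_monom)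
    ultimately show ?case
      using assms(2) by (auto simp: int_poly_def Q_def[symmetric])
  qed
  then show ?thesis
    using coeff_r[of k] by (metis int_poly_def)
qed simp

text \<open>The value at a new point \<open>s\<close> ranges over \<open>A\<close> minus the image
  of \<open>f\<close>. Summing over all of \<open>A\<close> splits off a power sum; subtracting the
  excluded values f(r) merges the exponent of \<open>s\<close> into that of \<open>r\<close>, so
  \<open>e\<close> varies in the induction.\<close>

lemma sum_injections_Ints:
  assumes A: "finite A" "\<And>k. (\<Sum>a\<in>A. a ^ k) \<in> (\<int> :: complex set)" and "finite S"
  shows "(\<Sum>f | f \<in> S \<rightarrow>\<^sub>E A \<and> inj_on f S. \<Prod>s\<in>S. f s ^ e s) \<in> \<int>"
  using \<open>finite S\<close>
proof (induction S arbitrary: e rule: finite_induct)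
  case (insert s S)
  define I where "I = {f. f \<in> S \<rightarrow>\<^sub>E A \<and> inj_on f S}"
  have "finite I"
    using A(1) insert.hyps(1) by (simp add: I_def finite_PiE)
  have "(\<Sum>f | f \<in> insert s S \<rightarrow>\<^sub>E A \<and> inj_on f (insert s S). \<Prod>t\<in>insert s S. f t ^ e t)
      = (\<Sum>(f, x)\<in>Sigma I (\<lambda>f. A - f ` S). x ^ e s * (\<Prod>t\<in>S. f t ^ e t))"
  \<comment> \<open>Resetting the value at \<open>s\<close> to \<open>undefined\<close> makes the
    restriction extensional on \<open>S\<close>.\<close>
  proof (rule sum.reindex_bij_witness[where i = "\<lambda>(f, x). f(s := x)" and j = "\<lambda>f. (f(s := undefined), f s)"])
    fix f assume f: "f \<in> {f. f \<in> insert s S \<rightarrow>\<^sub>E A \<and> inj_on f (insert s S)}"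
    have "f(s := undefined) \<in> S \<rightarrow>\<^sub>E A"
      using f insert.hyps(2) by (auto simp: PiE_iff extensional_def)
    moreover have "inj_on (f(s := undefined)) S"
      using f insert.hyps(2) by (auto simp: inj_on_def)
    moreover have "f s \<in> A" "f s \<notin> (f(s := undefined)) ` S"
      using f insert.hyps(2) by (auto simp: PiE_iff inj_on_def)
    ultimately show "(f(s := undefined), f s) \<in> Sigma I (\<lambda>f. A - f ` S)"
      by (auto simp: I_def)
    have "(\<Prod>t\<in>S. (f(s := undefined)) t ^ e t) = (\<Prod>t\<in>S. f t ^ e t)"
      using insert.hyps(2) by (intro prod.cong) auto
    then show "(case (f(s := undefined), f s) of (f, x) \<Rightarrow> x ^ e s * (\<Prod>t\<in>S. f t ^ e t))
        = (\<Prod>t\<in>insert s S. f t ^ e t)"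
      using insert.hyps by simp
  next
    fix p assume p: "p \<in> Sigma I (\<lambda>f. A - f ` S)"
    obtain f x where [simp]: "p = (f, x)"
      by (cases p)
    have "f s = undefined"
      using p insert.hyps(2) by (auto simp: I_def PiE_iff extensional_def)
    then show "(\<lambda>f. (f(s := undefined), f s)) (case p of (f, x) \<Rightarrow> f(s := x)) = p"
      by (auto simp: fun_eq_iff)
    show "(case p of (f, x) \<Rightarrow> f(s := x)) \<in> {f. f \<in> insert s S \<rightarrow>\<^sub>E A \<and> inj_on f (insert s S)}"
      using p insert.hyps(2) by (auto simp: I_def intro!: PiE_fun_upd inj_on_fun_updI)
  qed auto
  also have "\<dots> = (\<Sum>f\<in>I. \<Sum>x\<in>A - f ` S. x ^ e s * (\<Prod>t\<in>S. f t ^ e t))"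
    using \<open>finite I\<close> A(1) by (subst sum.Sigma) auto
  also have "\<dots> = (\<Sum>f\<in>I. (\<Sum>x\<in>A. x ^ e s) * (\<Prod>t\<in>S. f t ^ e t)
      - (\<Sum>r\<in>S. \<Prod>t\<in>S. f t ^ (e(r := e r + e s)) t))"
  proof (rule sum.cong[OF refl])
    fix f assume f: "f \<in> I"
    have "(\<Sum>x\<in>A - f ` S. x ^ e s) = (\<Sum>x\<in>A. x ^ e s) - (\<Sum>x\<in>f ` S. x ^ e s)"
      using f A(1) by (intro sum_diff) (auto simp: I_def)
    also have "(\<Sum>x\<in>f ` S. x ^ e s) = (\<Sum>r\<in>S. f r ^ e s)"
      using f by (simp add: sum.reindex I_def)
    finally have "(\<Sum>x\<in>A - f ` S. x ^ e s * (\<Prod>t\<in>S. f t ^ e t))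
        = (\<Sum>x\<in>A. x ^ e s) * (\<Prod>t\<in>S. f t ^ e t) - (\<Sum>r\<in>S. f r ^ e s * (\<Prod>t\<in>S. f t ^ e t))"
      by (simp add: sum_distrib_right[symmetric] left_diff_distrib)
    moreover have "f r ^ e s * (\<Prod>t\<in>S. f t ^ e t) = (\<Prod>t\<in>S. f t ^ (e(r := e r + e s)) t)" if "r \<in> S" for r
    proof -
      have "(\<Prod>t\<in>S. f t ^ (e(r := e r + e s)) t) = f r ^ (e r + e s) * (\<Prod>t\<in>S - {r}. f t ^ e t)"
        using that insert.hyps(1) by (simp add: prod.remove)
      then show ?thesis
        using that insert.hyps(1) by (simp add: prod.remove[of S r] power_add)
    qed
    ultimately show "(\<Sum>x\<in>A - f ` S. x ^ e s * (\<Prod>t\<in>S. f t ^ e t))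
        = (\<Sum>x\<in>A. x ^ e s) * (\<Prod>t\<in>S. f t ^ e t) - (\<Sum>r\<in>S. \<Prod>t\<in>S. f t ^ (e(r := e r + e s)) t)"
      by simp
  qed
  also have "\<dots> = (\<Sum>x\<in>A. x ^ e s) * (\<Sum>f\<in>I. \<Prod>t\<in>S. f t ^ e t)
      - (\<Sum>r\<in>S. \<Sum>f\<in>I. \<Prod>t\<in>S. f t ^ (e(r := e r + e s)) t)"
    by (simp only: sum_subtractf sum_distrib_left sum.swap[of _ I S])
  also have "\<dots> \<in> \<int>"
    unfolding I_def by (intro Ints_diff Ints_mult Ints_sum A(2) insert.IH)
  finally show ?case .
qed simp

text \<open>Injections of the finite set \<open>A\<close> into itself are permutations; only the
  convention outside \<open>A\<close> differs, \<open>undefined\<close> against the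
  identity.\<close>

lemma sum_permutations_Ints:
  assumes A: "finite A" "\<And>k. (\<Sum>a\<in>A. a ^ k) \<in> (\<int> :: complex set)"
  shows "(\<Sum>\<pi> | \<pi> permutes A. \<Prod>a\<in>A. \<pi> a ^ e a) \<in> \<int>"
proof -
  have "(\<Sum>\<pi> | \<pi> permutes A. \<Prod>a\<in>A. \<pi> a ^ e a)
      = (\<Sum>f | f \<in> A \<rightarrow>\<^sub>E A \<and> inj_on f A. \<Prod>a\<in>A. f a ^ e a)"
  proof (rule sum.reindex_bij_witness[where i = "\<lambda>f a. if a \<in> A then f a else a" and j = "\<lambda>\<pi>. restrict \<pi> A"])
    fix \<pi> assume "\<pi> \<in> {\<pi>. \<pi> permutes A}"
    then have \<pi>: "\<pi> permutes A"
      by simp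
    show "(\<lambda>a. if a \<in> A then restrict \<pi> A a else a) = \<pi>"
      using permutes_not_in[OF \<pi>] by (auto simp: fun_eq_iff)
    show "restrict \<pi> A \<in> {f. f \<in> A \<rightarrow>\<^sub>E A \<and> inj_on f A}"
      using permutes_in_image[OF \<pi>] permutes_inj_on[OF \<pi>] by auto
  next
    fix f assume f: "f \<in> {f. f \<in> A \<rightarrow>\<^sub>E A \<and> inj_on f A}"
    show "restrict (\<lambda>a. if a \<in> A then f a else a) A = f"
      using f by (auto simp: fun_eq_iff PiE_iff extensional_def)
    have "f ` A = A"
      using f A(1) by (intro endo_inj_surj) auto
    then have "bij_betw (\<lambda>a. if a \<in> A then f a else a) A A"
      using f by (auto simp: bij_betw_def inj_on_def)
    then show "(\<lambda>a. if a \<in> A then f a else a) \<in> {\<pi>. \<pi> permutes A}"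
      by (auto intro: bij_imp_permutes)
  qed simp
  also have "\<dots> \<in> \<int>"
    using A by (intro sum_injections_Ints)
  finally show ?thesis .
qed

text \<open>The polynomials with integer coefficients in the values \<open>\<pi> a\<close>, as functions of the permutation \<open>\<pi>\<close>.\<close>

inductive_set perm_poly :: "complex set \<Rightarrow> ((complex \<Rightarrow> complex) \<Rightarrow> complex) set" for A where
  one: "(\<lambda>\<pi>. 1) \<in> perm_poly A"
| diff: "h \<in> perm_poly A \<Longrightarrow> k \<in> perm_poly A \<Longrightarrow> (\<lambda>\<pi>. h \<pi> - k \<pi>) \<in> perm_poly A"
| var: "a \<in> A \<Longrightarrow> h \<in> perm_poly A \<Longrightarrow> (\<lambda>\<pi>. \<pi> a * h \<pi>) \<in> perm_poly A"

lemma perm_poly_0: "(\<lambda>\<pi>. 0) \<in> perm_poly A"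
  using perm_poly.diff[OF perm_poly.one perm_poly.one] by simp

lemma perm_poly_add: "h \<in> perm_poly A \<Longrightarrow> k \<in> perm_poly A \<Longrightarrow> (\<lambda>\<pi>. h \<pi> + k \<pi>) \<in> perm_poly A"
  using perm_poly.diff[OF _ perm_poly.diff[OF perm_poly_0], of h A k] by simp

lemma perm_poly_sum:
  "(\<And>x. x \<in> X \<Longrightarrow> h x \<in> perm_poly A) \<Longrightarrow> (\<lambda>\<pi>. \<Sum>x\<in>X. h x \<pi>) \<in> perm_poly A"
  by (induction X rule: infinite_finite_induct) (auto intro: perm_poly_0 perm_poly_add)

lemma perm_poly_mult:
  assumes "h \<in> perm_poly A" "k \<in> perm_poly A"
  shows "(\<lambda>\<pi>. h \<pi> * k \<pi>) \<in> perm_poly A"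
  using assms(1)
proof (induction rule: perm_poly.induct)
  case (diff h h')
  then show ?case
    using perm_poly.diff by (force simp: left_diff_distrib)
next
  case (var a h)
  then show ?case
    using perm_poly.var[of a A "\<lambda>\<pi>. h \<pi> * k \<pi>"] by (simp add: mult.assoc)
qed (simp add: assms(2))

lemma perm_poly_prod:
  "(\<And>x. x \<in> X \<Longrightarrow> h x \<in> perm_poly A) \<Longrightarrow> (\<lambda>\<pi>. \<Prod>x\<in>X. h x \<pi>) \<in> perm_poly A"
  by (induction X rule: infinite_finite_induct) (auto intro: perm_poly.one perm_poly_mult)

lemma perm_poly_power: "h \<in> perm_poly A \<Longrightarrow> (\<lambda>\<pi>. h \<pi> ^ n) \<in> perm_poly A"
  by (induction n) (auto intro: perm_poly.one perm_poly_mult)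

lemma perm_poly_apply: "a \<in> A \<Longrightarrow> (\<lambda>\<pi>. \<pi> a) \<in> perm_poly A"
  using perm_poly.var[OF _ perm_poly.one] by simp

lemma sum_perm_poly_Ints:
  assumes A: "finite A" "\<And>k. (\<Sum>a\<in>A. a ^ k) \<in> (\<int> :: complex set)" and h: "h \<in> perm_poly A"
  shows "(\<Sum>\<pi> | \<pi> permutes A. h \<pi>) \<in> \<int>"
proof -
  \<comment> \<open>The monomial serves as an accumulator: the case \<open>var\<close> moves its
    factor into the exponent of \<open>a\<close>.\<close>
  have "(\<Sum>\<pi> | \<pi> permutes A. h \<pi> * (\<Prod>a\<in>A. \<pi> a ^ e a)) \<in> \<int>" for e
    using h
  proof (induction arbitrary: e rule: perm_poly.induct)
    case one
    then show ?case
      using sum_permutations_Ints[OF A] by simp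
  next
    case (diff h k)
    then show ?case
      by (simp add: left_diff_distrib sum_subtractf)
  next
    case (var a h)
    have eq: "\<pi> a * h \<pi> * (\<Prod>x\<in>A. \<pi> x ^ e x) = h \<pi> * (\<Prod>x\<in>A. \<pi> x ^ (e(a := Suc (e a))) x)" for \<pi>
      using var.hyps(1) A(1) by (simp add: prod.remove[of A a] mult_ac)
    show ?case
      unfolding eq by (rule var.IH)
  qed
  from this[of "\<lambda>_. 0"] show ?thesis
    by simp
qed

subsection \<open>Root sets of rational polynomials\<close>

lemma map_poly_of_rat_mult:
  "map_poly of_rat (p * q) = (map_poly of_rat p * map_poly of_rat q :: complex poly)"
  by (rule poly_eqI) (simp add: coeff_map_poly coeff_mult of_rat_sum of_rat_mult)

lemma map_poly_of_rat_add:
  "map_poly of_rat (p + q) = (map_poly of_rat p + map_poly of_rat q :: complex poly)"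
  by (rule poly_eqI) (simp add: coeff_map_poly of_rat_add)

lemma map_poly_of_rat_pderiv:
  "map_poly of_rat (pderiv p) = (pderiv (map_poly of_rat p) :: complex poly)"
  by (rule poly_eqI) (simp add: coeff_map_poly coeff_pderiv of_rat_mult of_rat_add)

text \<open>Rational coefficients permit a gcd with the derivative later; the nonzero constant
  coefficient keeps 0 from becoming a root.\<close>

lemma exists_rat_poly:
  assumes "finite X" "\<And>x. x \<in> X \<Longrightarrow> algebraic x" "0 \<notin> X"
  obtains p where "p \<noteq> 0" "coeff p 0 \<noteq> 0"
    "\<And>x. x \<in> X \<Longrightarrow> poly (map_poly of_rat p) x = (0 :: complex)"
proof -
  have "\<exists>p. coeff p 0 \<noteq> 0 \<and> (\<forall>x\<in>X. poly (map_poly of_rat p) x = (0 :: complex))"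
    using assms
  proof (induction X rule: finite_induct)
    case empty
    show ?case
      by (rule exI[of _ 1]) simp
  next
    case (insert x X)
    then obtain p where p: "coeff p 0 \<noteq> 0" "\<forall>x\<in>X. poly (map_poly of_rat p) x = (0 :: complex)"
      by auto
    have "algebraic x" "x \<noteq> 0"
      using insert.prems by auto
    then obtain q :: "int poly" where q: "coeff q 0 \<noteq> 0" "poly (map_poly of_int q) x = 0"
      by (rule algebraicE'_nonzero)
    have "map_poly of_rat (map_poly of_int q) = (map_poly of_int q :: complex poly)"
      by (rule poly_eqI) (simp add: coeff_map_poly)
    then show ?case
      using p q by (intro exI[of _ "map_poly of_int q * p"])
        (simp add: map_poly_of_rat_mult coeff_mult coeff_map_poly)
  qed
  then show ?thesis
    using that by (metis coeff_0)
qed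

lemma common_denominator:
  assumes "finite C" "C \<subseteq> (\<rat> :: complex set)"
  obtains D :: nat where "D > 0" "\<And>c. c \<in> C \<Longrightarrow> of_nat D * c \<in> \<int>"
proof -
  have "\<exists>D::nat. D > 0 \<and> (\<forall>c\<in>C. of_nat D * c \<in> \<int>)"
    using assms
  proof (induction C rule: finite_induct)
    case empty
    show ?case
      by auto
  next
    case (insert c C)
    then obtain D :: nat where D: "D > 0" "\<forall>c\<in>C. of_nat D * c \<in> \<int>"
      by auto
    have "c \<in> \<rat>"
      using insert.prems by simp
    then obtain m n :: int where mn: "n > 0" "c = of_int m / of_int n"
      by (rule Rats_cases') blast
    have "of_nat (nat n * D) * d \<in> \<int>" if "d \<in> insert c C" for d
    proof (cases "d = c")
      case True
      have "of_nat (nat n * D) * d = of_int (int D * m)"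
        using mn True by simp
      then show ?thesis
        by (metis Ints_of_int)
    next
      case False
      then have "of_nat (nat n) * (of_nat D * d) \<in> \<int>"
        using that by (intro Ints_mult[OF Ints_of_nat bspec[OF D(2)]]) auto
      then show ?thesis
        by (simp add: mult.assoc)
    qed
    moreover have "nat n * D > 0"
      using mn(1) D(1) by simp
    ultimately show ?case
      by blast
  qed
  then show ?thesis
    using that by blast
qed

text \<open>Scaling the roots multiplies coefficient \<open>i\<close> by c^(card Y - i); the factor
  \<open>c ^ i\<close> avoids subtraction in the exponent.\<close>

lemma coeff_prod_scaled_roots:
  fixes c :: complex
  assumes "finite Y"
  shows "c ^ i * coeff (\<Prod>y\<in>Y. [:- (c * y), 1:]) i = c ^ card Y * coeff (\<Prod>y\<in>Y. [:- y, 1:]) i"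
  using assms
proof (induction Y arbitrary: i rule: finite_induct)
  case empty
  then show ?case
    by (cases i) auto
next
  case (insert x Y)
  show ?case
  proof (cases i)
    case 0
    then show ?thesis
      using insert.hyps insert.IH[of 0] by (simp add: mult_ac)
  next
    case (Suc j)
    have "c ^ i * coeff (\<Prod>y\<in>insert x Y. [:- (c * y), 1:]) i
        = c * (c ^ j * coeff (\<Prod>y\<in>Y. [:- (c * y), 1:]) j)
          - c * x * (c ^ i * coeff (\<Prod>y\<in>Y. [:- (c * y), 1:]) i)"
      using insert.hyps Suc by (simp add: algebra_simps)
    also have "\<dots> = c ^ card (insert x Y) * coeff (\<Prod>y\<in>insert x Y. [:- y, 1:]) i"
      unfolding insert.IH using insert.hyps Suc by (simp add: algebra_simps)
    finally show ?thesis .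
  qed
qed

text \<open>\<open>A\<close> consists of the roots of the squarefree part of a rational polynomial
  vanishing on \<open>X\<close>, scaled by a common denominator of its monic coefficients.\<close>

lemma exists_integral_root_set:
  assumes X: "finite X" "\<And>x. x \<in> X \<Longrightarrow> algebraic x" "0 \<notin> X"
  obtains A :: "complex set" and D :: nat
  where "finite A" "int_poly (\<Prod>a\<in>A. [:- a, 1:])" "0 \<notin> A" "D > 0" "\<And>x. x \<in> X \<Longrightarrow> of_nat D * x \<in> A"
proof (cases "X = {}")
  case True
  then show ?thesis
    using that[of "{}" 1] by (simp add: int_poly_def)
next
  case False
  then obtain x0 where x0: "x0 \<in> X"
    by blast
  define R where "R p = (map_poly of_rat p :: complex poly)" for p
  obtain p where p: "p \<noteq> 0" "coeff p 0 \<noteq> 0" "\<And>x. x \<in> X \<Longrightarrow> poly (R p) x = 0"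
    unfolding R_def using exists_rat_poly[OF X] by blast
  have R_eq_0: "R q = 0 \<longleftrightarrow> q = 0" for q
    by (auto simp: R_def poly_eq_iff coeff_map_poly)
  have "pderiv p \<noteq> 0"
  proof
    assume "pderiv p = 0"
    then obtain c where "p = [:c:]"
      by (auto simp: pderiv_eq_0_iff elim: degree_eq_zeroE)
    then show False
      using p(1) p(3)[OF x0] by (simp add: R_def map_poly_pCons)
  qed
  \<comment> \<open>Taking the gcd over the rationals keeps \<open>q\<close> rational. The Bezout
    identity carries over to complex polynomials, where \<open>q\<close> is squarefree with the
    roots of \<open>p\<close>.\<close>
  define d where "d = gcd p (pderiv p)"
  obtain q e where q: "p = q * d" and e: "pderiv p = e * d"
    unfolding d_def by (metis dvd_def gcd_dvd1 gcd_dvd2 mult.commute)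
  obtain r s where "d = r * p + s * pderiv p"
    unfolding d_def using bezout_coefficients_fst_snd[of p "pderiv p"] by metis
  then have Rd: "R d = R r * R p + R s * pderiv (R p)"
    by (simp add: R_def map_poly_of_rat_mult map_poly_of_rat_add map_poly_of_rat_pderiv)
  have Rp': "pderiv (R p) \<noteq> 0"
    using \<open>pderiv p \<noteq> 0\<close> R_eq_0 by (simp add: R_def flip: map_poly_of_rat_pderiv)
  have Rq: "R p = R q * R d"
    by (simp add: R_def q flip: map_poly_of_rat_mult)
  have Re: "pderiv (R p) = R e * R d"
    by (simp add: R_def e flip: map_poly_of_rat_mult map_poly_of_rat_pderiv)
  have "rsquarefree (R q) \<and> (\<forall>z. poly (R q) z = 0 \<longleftrightarrow> poly (R p) z = 0)"
    by (rule poly_squarefree_decomp[OF Rp' Rq Re Rd])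
  then have sqf: "rsquarefree (R q)" "\<And>z. poly (R q) z = 0 \<longleftrightarrow> poly (R p) z = 0"
    by blast+
  define Y where "Y = {z. poly (R q) z = 0}"
  have "R q \<noteq> 0"
    using sqf(1) by (auto simp: rsquarefree_def)
  then have "finite Y"
    by (simp add: Y_def poly_roots_finite)
  have decomp: "smult (lead_coeff (R q)) (\<Prod>y\<in>Y. [:- y, 1:]) = R q"
    unfolding Y_def by (rule complex_poly_decompose_rsquarefree[OF sqf(1)])
  define Q where "Q = (\<Prod>y\<in>Y. [:- y, 1:])"
  have Q_Rats: "coeff Q i \<in> \<rat>" for i
  proof -
    have "lead_coeff (R q) * coeff Q i = coeff (R q) i"
      using arg_cong[OF decomp, of "\<lambda>p. coeff p i"] by (simp add: Q_def)
    then have "coeff Q i = coeff (R q) i / lead_coeff (R q)"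
      using \<open>R q \<noteq> 0\<close> by (simp add: field_simps)
    then show ?thesis
      by (simp add: R_def coeff_map_poly)
  qed
  have "finite (coeff Q ` {..card Y})" "coeff Q ` {..card Y} \<subseteq> \<rat>"
    using Q_Rats by auto
  then obtain D :: nat where D: "D > 0" "\<And>c. c \<in> coeff Q ` {..card Y} \<Longrightarrow> of_nat D * c \<in> \<int>"
    by (rule common_denominator) blast
  define A where "A = (\<lambda>y. of_nat D * y) ` Y"
  have "inj_on (\<lambda>y. of_nat D * y) Y"
    using D(1) by (auto simp: inj_on_def)
  then have QA: "(\<Prod>a\<in>A. [:- a, 1:]) = (\<Prod>y\<in>Y. [:- (of_nat D * y), 1:])"
    by (simp add: A_def prod.reindex)
  have deg: "degree (\<Prod>y\<in>Y. [:- (c * y), 1:]) = card Y" for c :: complex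
    by (subst degree_prod_sum_eq) auto
  have "coeff (\<Prod>a\<in>A. [:- a, 1:]) i \<in> \<int>" for i
  proof (cases i "card Y" rule: linorder_cases)
    case less
    have "of_nat D ^ i * coeff (\<Prod>a\<in>A. [:- a, 1:]) i = of_nat D ^ card Y * coeff Q i"
      unfolding QA Q_def by (rule coeff_prod_scaled_roots[OF \<open>finite Y\<close>])
    also have "of_nat D ^ card Y = (of_nat D ^ i * of_nat D ^ (card Y - i) :: complex)"
      using less by (simp flip: power_add)
    finally have "coeff (\<Prod>a\<in>A. [:- a, 1:]) i = of_nat D ^ (card Y - i) * coeff Q i"
      using D(1) by simp
    \<comment> \<open>Below the leading coefficient at least one factor \<open>D\<close> is
      available to clear the denominator of \<open>coeff Q i\<close>.\<close>
    also have "\<dots> = of_nat (D ^ (card Y - Suc i)) * (of_nat D * coeff Q i)"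
      using less by (simp add: Suc_diff_Suc flip: power_Suc2 mult.assoc)
    also have "\<dots> \<in> \<int>"
      using less by (intro Ints_mult[OF Ints_of_nat D(2)]) auto
    finally show ?thesis .
  next
    case equal
    have "lead_coeff (\<Prod>y\<in>Y. [:- (of_nat D * y), 1:]) = (1 :: complex)"
      by (simp add: lead_coeff_prod)
    then show ?thesis
      unfolding QA equal deg by simp
  next
    case greater
    then show ?thesis
      unfolding QA using deg[of "of_nat D"] by (simp add: coeff_eq_0)
  qed
  then have "int_poly (\<Prod>a\<in>A. [:- a, 1:])"
    unfolding int_poly_def by blast
  moreover have "0 \<notin> A"
  proof
    assume "0 \<in> A"
    then have "0 \<in> Y"
      using D(1) by (auto simp: A_def)
    then have "poly (R p) 0 = 0"
      using sqf(2) by (simp add: Y_def)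
    then show False
      using p(2) by (simp add: R_def poly_0_coeff_0 coeff_map_poly)
  qed
  moreover have "of_nat D * x \<in> A" if "x \<in> X" for x
    unfolding A_def using p(3)[OF that] sqf(2) by (intro imageI) (simp add: Y_def)
  moreover have "finite A"
    using \<open>finite Y\<close> by (simp add: A_def)
  ultimately show ?thesis
    using that D(1) by blast
qed

subsection \<open>The Lindemann-Weierstrass theorem\<close>

text \<open>If the series were zero, its coefficients would give sum c_s f(x_s) = 0 for all
  polynomials f; one that vanishes at all points but \<open>x s\<close> contradicts
  \<open>c s \<noteq> 0\<close>.\<close>

lemma sum_fps_exp_nonzero:
  fixes c x :: "'a \<Rightarrow> complex"
  assumes "finite S" "inj_on x S" "s \<in> S" "c s \<noteq> 0"
  shows "(\<Sum>s\<in>S. fps_const (c s) * fps_exp (x s)) \<noteq> 0"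
proof
  assume eq_0: "(\<Sum>s\<in>S. fps_const (c s) * fps_exp (x s)) = 0"
  have powers: "(\<Sum>s\<in>S. c s * x s ^ n) = 0" for n
  proof -
    have "(\<Sum>s\<in>S. c s * x s ^ n) / fact n = fps_nth (\<Sum>s\<in>S. fps_const (c s) * fps_exp (x s)) n"
      by (simp add: fps_sum_nth sum_divide_distrib)
    then show ?thesis
      by (simp add: eq_0)
  qed
  have polys: "(\<Sum>s\<in>S. c s * poly f (x s)) = 0" for f
  proof -
    have "(\<Sum>s\<in>S. c s * poly f (x s)) = (\<Sum>s\<in>S. \<Sum>i\<le>degree f. coeff f i * (c s * x s ^ i))"
      by (simp add: poly_altdef sum_distrib_left mult_ac)
    also have "\<dots> = (\<Sum>i\<le>degree f. coeff f i * (\<Sum>s\<in>S. c s * x s ^ i))"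
      unfolding sum_distrib_left by (rule sum.swap)
    finally show ?thesis
      by (simp add: powers)
  qed
  define f where "f = (\<Prod>t\<in>S - {s}. [:- x t, 1:])"
  have "(\<Sum>t\<in>S. c t * poly f (x t)) = c s * poly f (x s)"
    using assms(1,3) by (subst sum.remove[of S s]) (auto simp: f_def poly_prod intro!: sum.neutral)
  moreover have "poly f (x s) \<noteq> 0"
    using assms(1-3) by (auto simp: f_def poly_prod inj_on_def)
  ultimately show False
    using polys assms(4) by simp
qed

lemma prod_fps_exp:
  fixes c x :: "'a \<Rightarrow> complex"
  shows "(\<Prod>i\<in>I. fps_const (c i) * fps_exp (x i)) = fps_const (\<Prod>i\<in>I. c i) * fps_exp (\<Sum>i\<in>I. x i)"
proof (induction I rule: infinite_finite_induct)
  case (insert i I)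
  then show ?case
    by (simp add: fps_exp_add_mult mult_ac flip: fps_const_mult)
qed auto

text \<open>The product over all permutations of \<open>A\<close> replaces a Galois norm. Its
  coefficients are rational by symmetry, so \<open>u_eq_0\<close> makes the power series zero,
  although none of its factors is.\<close>

lemma sum_exp_nonzero_if_integral:
  fixes A :: "complex set" and c :: "complex \<Rightarrow> complex"
  assumes A: "finite A" "int_poly (\<Prod>a\<in>A. [:- a, 1:])" "0 \<notin> A" and D: "D > 0"
    and S: "S \<subseteq> A" "S \<noteq> {}" "c ` S \<subseteq> A"
  shows "(\<Sum>a\<in>S. c a * exp (a / of_nat D)) \<noteq> 0"
proof
  assume sum_0: "(\<Sum>a\<in>S. c a * exp (a / of_nat D)) = 0"
  have "finite S"
    using S(1) A(1) by (rule finite_subset)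
  define P where "P = {\<pi>. \<pi> permutes A}"
  have "finite P"
    unfolding P_def by (rule finite_permutations[OF A(1)])
  have "id \<in> P"
    by (simp add: P_def permutes_id)
  have P_A: "\<pi> a \<in> A" if "\<pi> \<in> P" "a \<in> A" for \<pi> a
    using that permutes_in_image[of \<pi> A a] by (simp add: P_def)
  \<comment> \<open>An element of \<open>J\<close> selects one summand from each factor of the
    product.\<close>
  define J where "J = P \<rightarrow>\<^sub>E S"
  have "finite J"
    unfolding J_def using \<open>finite P\<close> \<open>finite S\<close> by (rule finite_PiE)
  have J: "\<phi> \<pi> \<in> S" if "\<phi> \<in> J" "\<pi> \<in> P" for \<phi> \<pi>
    using that by (auto simp: J_def)
  have J_A: "\<pi> (\<phi> \<pi>) \<in> A" "\<pi> (c (\<phi> \<pi>)) \<in> A" if "\<phi> \<in> J" "\<pi> \<in> P" for \<phi> \<pi>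
    using J[OF that] S(1,3) P_A[OF that(2)] by auto
  \<comment> \<open>The choice \<open>id\<close> for \<open>\<rho>\<close> gives the product of
    interest; as functions of \<open>\<rho>\<close>, \<open>B\<close> and \<open>g\<close> are
    members of \<open>perm_poly A\<close>, ready for summation over all permutations.\<close>
  define B where "B \<rho> \<phi> = (\<Prod>\<pi>\<in>P. \<rho> (\<pi> (c (\<phi> \<pi>))))" for \<rho> :: "complex \<Rightarrow> complex" and \<phi>
  define g where "g \<rho> \<phi> = (\<Sum>\<pi>\<in>P. \<rho> (\<pi> (\<phi> \<pi>)))" for \<rho> :: "complex \<Rightarrow> complex" and \<phi>
  define G where "G \<rho> = (\<Prod>\<pi>\<in>P. \<Sum>a\<in>S. fps_const (\<rho> (\<pi> (c a))) * fps_exp (\<rho> (\<pi> a) / of_nat D))"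
    for \<rho> :: "complex \<Rightarrow> complex"
  have G_expand: "G \<rho> = (\<Sum>\<phi>\<in>J. fps_const (B \<rho> \<phi>) * fps_exp (g \<rho> \<phi> / of_nat D))"
    for \<rho> :: "complex \<Rightarrow> complex"
    unfolding G_def J_def B_def g_def using \<open>finite P\<close> \<open>finite S\<close>
    by (subst prod_sum_PiE) (simp_all add: prod_fps_exp sum_divide_distrib)
  \<comment> \<open>Left composition with \<open>\<rho>\<close> only permutes the factors.\<close>
  have G_invariant: "G \<rho> = G id" if "\<rho> \<in> P" for \<rho>
  proof -
    have "\<rho> permutes A"
      using that by (simp add: P_def)
    have "(\<Prod>\<pi>\<in>P. \<Sum>a\<in>S. fps_const ((\<rho> \<circ> \<pi>) (c a)) * fps_exp ((\<rho> \<circ> \<pi>) a / of_nat D))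
        = (\<Prod>\<pi>\<in>P. \<Sum>a\<in>S. fps_const (\<pi> (c a)) * fps_exp (\<pi> a / of_nat D))"
    proof (rule prod.reindex_bij_witness[where i = "\<lambda>\<pi>. inv \<rho> \<circ> \<pi>" and j = "\<lambda>\<pi>. \<rho> \<circ> \<pi>"])
      show "inv \<rho> \<circ> (\<rho> \<circ> \<pi>) = \<pi>" "\<rho> \<circ> (inv \<rho> \<circ> \<pi>) = \<pi>" for \<pi>
        using permutes_inverses[OF \<open>\<rho> permutes A\<close>] by (auto simp: fun_eq_iff)
      show "\<rho> \<circ> \<pi> \<in> P" "inv \<rho> \<circ> \<pi> \<in> P" if "\<pi> \<in> P" for \<pi>
        using that \<open>\<rho> permutes A\<close> by (auto simp: P_def intro: permutes_compose permutes_inv)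
    qed simp
    then show ?thesis
      by (simp add: G_def)
  qed
  interpret E: exp_sum J "B id" "\<lambda>\<phi>. g id \<phi> / of_nat D"
    by standard (rule \<open>finite J\<close>)
  have u_eq: "E.u m = fact m * fps_nth (G id) m" for m
    by (simp add: E.u_def G_expand fps_sum_nth sum_divide_distrib[symmetric])

  have "(\<Sum>a\<in>S. fps_const (\<pi> (c a)) * fps_exp (\<pi> a / of_nat D)) \<noteq> 0" if "\<pi> \<in> P" for \<pi>
  proof -
    have "\<pi> permutes A"
      using that by (simp add: P_def)
    obtain s where "s \<in> S"
      using S(2) by blast
    show ?thesis
    proof (rule sum_fps_exp_nonzero[OF \<open>finite S\<close> _ \<open>s \<in> S\<close>])
      show "inj_on (\<lambda>a. \<pi> a / of_nat D) S"
        using D permutes_inj[OF \<open>\<pi> permutes A\<close>] by (auto simp: inj_on_def)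
      show "\<pi> (c s) \<noteq> 0"
        using P_A[OF that, of "c s"] S(3) \<open>s \<in> S\<close> A(3) by auto
    qed
  qed
  then have "G id \<noteq> 0"
    using \<open>finite P\<close> by (simp add: G_def)
  then obtain m where "fps_nth (G id) m \<noteq> 0"
    by (auto simp: fps_nonzero_nth)
  then have "E.u m \<noteq> 0"
    by (simp add: u_eq)
  moreover have "E.u m = 0"
  proof -
    have "(\<Sum>\<phi>\<in>J. B id \<phi> * exp (g id \<phi> / of_nat D)) = (\<Sum>\<phi>\<in>J. \<Prod>\<pi>\<in>P. \<pi> (c (\<phi> \<pi>)) * exp (\<pi> (\<phi> \<pi>) / of_nat D))"
      by (simp add: B_def g_def prod.distrib sum_divide_distrib exp_sum[OF \<open>finite P\<close>])
    also have "\<dots> = (\<Prod>\<pi>\<in>P. \<Sum>a\<in>S. \<pi> (c a) * exp (\<pi> a / of_nat D))"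
      unfolding J_def using \<open>finite P\<close> \<open>finite S\<close> by (subst prod_sum_PiE) simp_all
    \<comment> \<open>The factor at \<open>id\<close> is the sum assumed to vanish.\<close>
    also have "\<dots> = 0"
      using \<open>finite P\<close> \<open>id \<in> P\<close> sum_0 by (intro prod_zero bexI[of _ id]) auto
    finally have E_sum: "(\<Sum>\<phi>\<in>J. B id \<phi> * exp (g id \<phi> / of_nat D)) = 0" .

    have alg_A: "algebraic a" if "a \<in> A" for a
      using A that by (intro algebraicI[of "\<Prod>a\<in>A. [:- a, 1:]"]) (auto simp: int_poly_def poly_prod)
    have "algebraic (g id \<phi> / of_nat D)" if "\<phi> \<in> J" for \<phi>
    proof -
      have "algebraic (g id \<phi>)"
        unfolding g_def using that by (intro algebraic_sum alg_A) (use J_A in auto)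
      moreover have "algebraic (inverse (of_nat D) :: complex)"
        by (intro algebraic_inverse) simp
      ultimately show ?thesis
        unfolding divide_inverse by (rule algebraic_mult)
    qed
    then have "algebraic z" if "z \<in> (\<lambda>\<phi>. g id \<phi> / of_nat D) ` J" for z
      using that by blast
    then obtain T where T: "int_poly T" "T \<noteq> 0" "\<And>z. z \<in> (\<lambda>\<phi>. g id \<phi> / of_nat D) ` J \<Longrightarrow> poly T z = 0"
      using exists_int_poly[OF finite_imageI[OF \<open>finite J\<close>]] by blast

    \<comment> \<open>By invariance \<open>h\<close> is constant on \<open>P\<close>, and its sum
      over \<open>P\<close> is an integer; hence the factor \<open>card P\<close>. The power of
      \<open>D\<close> undoes the division of the exponents by \<open>D\<close>.\<close>
    have integral: "of_int (int (card P)) * of_nat D ^ n * E.u n \<in> \<int>" for n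
    proof -
      define h where "h = (\<lambda>\<rho>. \<Sum>\<phi>\<in>J. B \<rho> \<phi> * g \<rho> \<phi> ^ n)"
      have h_eq: "h \<rho> = of_nat D ^ n * fact n * fps_nth (G \<rho>) n" for \<rho>
        using D by (simp add: h_def G_expand fps_sum_nth sum_distrib_left power_divide)
      have "(\<lambda>\<rho>. B \<rho> \<phi>) \<in> perm_poly A" "(\<lambda>\<rho>. g \<rho> \<phi>) \<in> perm_poly A" if "\<phi> \<in> J" for \<phi>
        unfolding B_def g_def
        by (rule perm_poly_prod, rule perm_poly_apply, rule J_A(2)[OF that], assumption)
          (rule perm_poly_sum, rule perm_poly_apply, rule J_A(1)[OF that], assumption)
      then have "h \<in> perm_poly A"
        unfolding h_def by (intro perm_poly_sum perm_poly_mult perm_poly_power)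
      then have "(\<Sum>\<rho>\<in>P. h \<rho>) \<in> \<int>"
        unfolding P_def using power_sum_Ints[OF A(1,2)] by (intro sum_perm_poly_Ints[OF A(1)])
      moreover have "(\<Sum>\<rho>\<in>P. h \<rho>) = (\<Sum>\<rho>\<in>P. of_nat D ^ n * fact n * fps_nth (G id) n)"
        by (intro sum.cong) (simp_all add: h_eq G_invariant)
      ultimately show ?thesis
        by (simp add: u_eq mult.assoc)
    qed
    have "card P \<noteq> 0"
      using \<open>finite P\<close> \<open>id \<in> P\<close> by auto
    then show ?thesis
      using E.u_eq_0[OF E_sum T(1,2) T(3)[OF imageI] integral _ D] by simp
  qed
  ultimately show False
    by contradiction
qed

text \<open>Zero coefficients are dropped, exponents are shifted by a natural number, and everything
  is scaled by \<open>D\<close> into an integral root set. The shift multiplies the sum by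
  exp(k).\<close>

theorem Lindemann_Weierstrass:
  fixes c :: "complex \<Rightarrow> complex"
  assumes "finite S" "\<And>a. a \<in> S \<Longrightarrow> algebraic a" "\<And>a. a \<in> S \<Longrightarrow> algebraic (c a)"
    and sum_0: "(\<Sum>a\<in>S. c a * exp a) = 0" and "a \<in> S"
  shows "c a = 0"
proof (rule ccontr)
  assume "c a \<noteq> 0"
  define S' where "S' = {a \<in> S. c a \<noteq> 0}"
  have S': "finite S'" "S' \<noteq> {}"
    using assms(1,5) \<open>c a \<noteq> 0\<close> by (auto simp: S'_def)
  \<comment> \<open>No shifted exponent a + k may be 0, since the root set avoids 0.\<close>
  obtain k :: nat where k: "of_nat k \<notin> uminus ` S'"
    using S'(1) ex_new_if_finite[of "of_nat -` uminus ` S' :: nat set"]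
    by (auto simp: finite_vimageI inj_on_def)
  define X where "X = (\<lambda>a. a + of_nat k) ` S' \<union> c ` S'"
  have "finite X"
    using S'(1) by (simp add: X_def)
  moreover have "algebraic x" if "x \<in> X" for x
    using that assms(2,3) by (auto simp: X_def S'_def intro: algebraic_add)
  moreover have "0 \<notin> X"
    using k by (auto simp: X_def S'_def eq_neg_iff_add_eq_0 add.commute image_iff)
  ultimately obtain A and D :: nat where A: "finite A" "int_poly (\<Prod>a\<in>A. [:- a, 1:])" "0 \<notin> A" "D > 0"
    and XA: "\<And>x. x \<in> X \<Longrightarrow> of_nat D * x \<in> A"
    by (rule exists_integral_root_set) blast+
  define f where "f a = of_nat D * (a + of_nat k)" for a :: complex
  define h where "h z = z / of_nat D - of_nat k" for z :: complex
  have hf: "h (f a) = a" for a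
    using A(4) by (simp add: h_def f_def)
  have "inj_on f S'"
    by (rule inj_on_inverseI[of S' h f]) (simp add: hf)
  have "(\<Sum>z\<in>f ` S'. of_nat D * c (h z) * exp (z / of_nat D)) \<noteq> 0"
  proof (rule sum_exp_nonzero_if_integral[OF A])
    show "f ` S' \<subseteq> A" "(\<lambda>z. of_nat D * c (h z)) ` f ` S' \<subseteq> A"
      using XA by (auto simp: X_def f_def[symmetric] hf) (auto simp: f_def)
    show "f ` S' \<noteq> {}"
      using S'(2) by simp
  qed
  also have "(\<Sum>z\<in>f ` S'. of_nat D * c (h z) * exp (z / of_nat D))
      = (\<Sum>a\<in>S'. of_nat D * exp (of_nat k) * (c a * exp a))"
    using \<open>inj_on f S'\<close> A(4) by (simp add: sum.reindex hf) (simp add: f_def exp_add mult_ac)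
  also have "\<dots> = of_nat D * exp (of_nat k) * (\<Sum>a\<in>S. c a * exp a)"
    unfolding sum_distrib_left[symmetric] S'_def using assms(1)
    by (intro arg_cong[of _ _ "\<lambda>z. of_nat D * exp (of_nat k) * z"] sum.mono_neutral_left) auto
  finally show False
    by (simp add: sum_0)
qed

subsection \<open>The polynomial ring modulo the ideal\<close>

abbreviation ideal_gens :: "mpoly set" where
  "ideal_gens \<equiv> gen_ideal Aring gens"

section \<open>Evaluation as a ring homomorphism\<close>

definition monom_val :: "(var \<Rightarrow>\<^sub>0 nat) \<Rightarrow> complex" where
  "monom_val m = (\<Prod>v\<in>Poly_Mapping.keys m. var_val v ^ Poly_Mapping.lookup m v)"

lemma monom_val_superset:
  assumes "finite V" "Poly_Mapping.keys m \<subseteq> V"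
  shows "monom_val m = (\<Prod>v\<in>V. var_val v ^ Poly_Mapping.lookup m v)"
  unfolding monom_val_def
  by (rule prod.mono_neutral_left) (use assms in \<open>auto simp: in_keys_iff\<close>)

lemma monom_val_add: "monom_val (m + n) = monom_val m * monom_val n"
proof -
  define V where "V = Poly_Mapping.keys m \<union> Poly_Mapping.keys n"
  have V: "finite V" "Poly_Mapping.keys m \<subseteq> V" "Poly_Mapping.keys n \<subseteq> V" "Poly_Mapping.keys (m + n) \<subseteq> V"
    using keys_add[of m n] by (auto simp: V_def)
  then show ?thesis
    by (simp add: monom_val_superset[of V] lookup_add power_add prod.distrib)
qed

lemma ev_superset:
  assumes "finite M" "Poly_Mapping.keys p \<subseteq> M"
  shows "ev p = (\<Sum>m\<in>M. Poly_Mapping.lookup p m * monom_val m)"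
  unfolding ev_def monom_val_def[symmetric]
  by (rule sum.mono_neutral_left) (use assms in \<open>auto simp: in_keys_iff\<close>)

lemma ev_0 [simp]: "ev 0 = 0"
  by (simp add: ev_def)

lemma ev_add: "ev (p + q) = ev p + ev q"
proof -
  define M where "M = Poly_Mapping.keys p \<union> Poly_Mapping.keys q"
  have M: "finite M" "Poly_Mapping.keys p \<subseteq> M" "Poly_Mapping.keys q \<subseteq> M" "Poly_Mapping.keys (p + q) \<subseteq> M"
    using keys_add[of p q] by (auto simp: M_def)
  then show ?thesis
    by (simp add: ev_superset[of M] lookup_add distrib_right sum.distrib)
qed

lemma ev_diff: "ev (p - q) = ev p - ev q"
  using ev_add[of "p - q" q] by simp

lemma ev_sum: "ev (\<Sum>x\<in>X. f x) = (\<Sum>x\<in>X. ev (f x))"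
  by (induction X rule: infinite_finite_induct) (auto simp: ev_add)

lemma ev_single: "ev (Poly_Mapping.single m c) = c * monom_val m"
  by (cases "c = 0") (simp_all add: ev_def monom_val_def)

text \<open>Used at two types: for polynomials as sums of terms and for exponent vectors as sums of
  single exponents.\<close>

lemma sum_singles:
  "(\<Sum>k\<in>Poly_Mapping.keys p. Poly_Mapping.single k (Poly_Mapping.lookup p k)) = p"
  by (rule poly_mapping_eqI)
    (auto simp: lookup_sum lookup_single when_def in_keys_iff sum.delta')

lemma mult_eq_sum_singles:
  fixes p q :: mpoly
  shows "p * q = (\<Sum>m\<in>Poly_Mapping.keys p. \<Sum>n\<in>Poly_Mapping.keys q.
    Poly_Mapping.single (m + n) (Poly_Mapping.lookup p m * Poly_Mapping.lookup q n))"
  by (subst sum_singles[of p, symmetric], subst sum_singles[of q, symmetric])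
    (simp only: sum_product mult_single)

lemma ev_mult: "ev (p * q) = ev p * ev q"
proof -
  have "ev (p * q) = (\<Sum>m\<in>Poly_Mapping.keys p. \<Sum>n\<in>Poly_Mapping.keys q.
      (Poly_Mapping.lookup p m * monom_val m) * (Poly_Mapping.lookup q n * monom_val n))"
    by (simp add: mult_eq_sum_singles ev_sum ev_single monom_val_add mult_ac)
  also have "\<dots> = ev p * ev q"
    by (simp add: ev_def monom_val_def sum_product)
  finally show ?thesis .
qed

definition Const :: "complex \<Rightarrow> mpoly" where
  "Const c = Poly_Mapping.single 0 c"

lemma Const_mult: "Const (c * d) = Const c * Const d"
  by (simp add: Const_def mult_single)

lemma Const_add: "Const (c + d) = Const c + Const d"
  by (simp add: Const_def single_add)

lemma Const_0 [simp]: "Const 0 = 0" and Const_1 [simp]: "Const 1 = 1" and Const_minus: "Const (- c) = - Const c"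
  by (simp_all add: Const_def single_uminus)

lemma ev_Const [simp]: "ev (Const c) = c"
  by (simp add: Const_def ev_single monom_val_def)

lemma ev_1 [simp]: "ev 1 = 1"
  using ev_Const[of 1] by simp

lemma ev_PX [simp]: "ev (PX a) = cos a" and ev_PY [simp]: "ev (PY a) = sin a"
  by (simp_all add: PX_def PY_def PVar_def ev_single monom_val_def)

section \<open>Closure properties of the polynomial ring over the algebraic numbers\<close>

lemma Aring_single:
  assumes "algebraic c" "\<And>v. v \<in> Poly_Mapping.keys m \<Longrightarrow> algebraic (var_index v)"
  shows "Poly_Mapping.single m c \<in> Aring"
  using assms by (auto simp: Aring_def lookup_single when_def split: if_splits)

lemma Aring_0: "0 \<in> Aring"
  by (simp add: Aring_def)

lemma Aring_add: "p \<in> Aring \<Longrightarrow> q \<in> Aring \<Longrightarrow> p + q \<in> Aring"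
  using keys_add[of p q] by (auto simp: Aring_def lookup_add intro: algebraic_add)

lemma Aring_minus: "p \<in> Aring \<Longrightarrow> - p \<in> Aring"
  by (auto simp: Aring_def)

lemma Aring_diff: "p \<in> Aring \<Longrightarrow> q \<in> Aring \<Longrightarrow> p - q \<in> Aring"
  using Aring_add[OF _ Aring_minus, of p q] by simp

lemma Aring_sum: "(\<And>x. x \<in> X \<Longrightarrow> f x \<in> Aring) \<Longrightarrow> (\<Sum>x\<in>X. f x) \<in> Aring"
  by (induction X rule: infinite_finite_induct) (auto intro: Aring_0 Aring_add)

lemma Aring_mult:
  assumes "p \<in> Aring" "q \<in> Aring"
  shows "p * q \<in> Aring"
  unfolding mult_eq_sum_singles
proof (intro Aring_sum Aring_single)
  fix m n v
  assume m: "m \<in> Poly_Mapping.keys p" and n: "n \<in> Poly_Mapping.keys q" and "v \<in> Poly_Mapping.keys (m + n)"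
  then have "v \<in> Poly_Mapping.keys m \<or> v \<in> Poly_Mapping.keys n"
    using keys_add[of m n] by blast
  then show "algebraic (var_index v)"
    using assms m n by (auto simp: Aring_def)
next
  show "algebraic (Poly_Mapping.lookup p m * Poly_Mapping.lookup q n)" for m n
    using assms by (auto simp: Aring_def intro: algebraic_mult)
qed

lemma Aring_Const: "algebraic c \<Longrightarrow> Const c \<in> Aring"
  unfolding Const_def by (rule Aring_single) auto

lemma Aring_1: "1 \<in> Aring"
  using Aring_Const[of 1] by simp

lemma Aring_PVar: "algebraic (var_index v) \<Longrightarrow> PVar v \<in> Aring"
  unfolding PVar_def by (rule Aring_single) auto

lemma Aring_PX: "algebraic a \<Longrightarrow> PX a \<in> Aring" and Aring_PY: "algebraic a \<Longrightarrow> PY a \<in> Aring"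
  by (simp_all add: PX_def PY_def Aring_PVar)

section \<open>The ideal and its containment in the kernel\<close>

lemma gens_subset: "gens \<subseteq> {p \<in> Aring. ev p = 0}"
proof
  fix p assume "p \<in> gens"
  then obtain a b where ab: "algebraic a" "algebraic b" and
    p: "p = PX a ^ 2 + PY a ^ 2 - 1 \<or> p = PX (a + b) - PX a * PX b + PY a * PY b \<or>
      p = PY (a + b) - PY a * PX b - PX a * PY b"
    by (auto simp: gens_def)
  have "p \<in> Aring"
    using p ab by (auto simp: power2_eq_square
        intro!: Aring_add Aring_diff Aring_mult Aring_1 Aring_PX Aring_PY algebraic_add)
  moreover have "ev p = 0"
    using p by (auto simp: power2_eq_square ev_add ev_diff ev_mult cos_add sin_add
        simp flip: sin_squared_eq)
  ultimately show "p \<in> {p \<in> Aring. ev p = 0}"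
    by simp
qed

lemma ideal_subset: "ideal_gens \<subseteq> {p \<in> Aring. ev p = 0}"
proof
  show "p \<in> {p \<in> Aring. ev p = 0}" if "p \<in> ideal_gens" for p
    using that
  proof (induction rule: gen_ideal.induct)
    case (step p r g)
    then show ?case
      using gens_subset by (auto simp: ev_add ev_mult intro: Aring_add Aring_mult)
  qed (simp add: Aring_0)
qed

lemma ideal_add:
  assumes "p \<in> ideal_gens" "q \<in> ideal_gens"
  shows "p + q \<in> ideal_gens"
  using assms(2)
proof (induction rule: gen_ideal.induct)
  case (step q r g)
  then show ?case
    using gen_ideal.step[of "p + q" Aring gens r g] by (simp add: add.assoc)
qed (simp add: assms(1))

lemma ideal_mult:
  assumes "r \<in> Aring" "p \<in> ideal_gens"
  shows "r * p \<in> ideal_gens"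
  using assms(2)
proof (induction rule: gen_ideal.induct)
  case (step p s g)
  then show ?case
    using gen_ideal.step[of "r * p" Aring gens "r * s" g] assms(1)
    by (simp add: distrib_left mult.assoc Aring_mult)
qed (simp add: gen_ideal.zero)

lemma ideal_minus: "p \<in> ideal_gens \<Longrightarrow> - p \<in> ideal_gens"
  using ideal_mult[OF Aring_minus[OF Aring_1]] by simp

lemma ideal_diff: "p \<in> ideal_gens \<Longrightarrow> q \<in> ideal_gens \<Longrightarrow> p - q \<in> ideal_gens"
  using ideal_add[OF _ ideal_minus, of p q] by simp

lemma ideal_base: "g \<in> gens \<Longrightarrow> g \<in> ideal_gens"
  using gen_ideal.step[OF gen_ideal.zero Aring_1, of g] by simp

text \<open>Modulo the ideal, \<open>PE a\<close> behaves like the exponential \<open>exp (\<i> * a)\<close> that it evaluates to.\<close>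

definition PE :: "complex \<Rightarrow> mpoly" where
  "PE a = PX a + Const \<i> * PY a"

text \<open>The conjugate expression: an inverse of \<open>PE a\<close> modulo the ideal, to be
  identified with \<open>PE (- a)\<close>.\<close>

definition PF :: "complex \<Rightarrow> mpoly" where
  "PF a = PX a - Const \<i> * PY a"

lemma Const_ii: "Const \<i> * Const \<i> + 1 = 0"
  by (simp flip: Const_mult add: Const_minus)

lemma Aring_PE: "algebraic a \<Longrightarrow> PE a \<in> Aring" and Aring_PF: "algebraic a \<Longrightarrow> PF a \<in> Aring"
  by (auto simp: PE_def PF_def intro!: Aring_add Aring_diff Aring_mult Aring_PX Aring_PY Aring_Const)

lemma ev_PE: "ev (PE a) = exp (\<i> * a)"
  by (simp add: PE_def ev_add ev_mult exp_Euler)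

lemma PE_add:
  assumes "algebraic a" "algebraic b"
  shows "PE (a + b) - PE a * PE b \<in> ideal_gens"
proof -
  \<comment> \<open>The last summand is zero; it is included so that the identity holds in any
    commutative ring, with \<open>Const \<i>\<close> as an opaque element.\<close>
  have "PE (a + b) - PE a * PE b = (PX (a + b) - PX a * PX b + PY a * PY b)
      + Const \<i> * (PY (a + b) - PY a * PX b - PX a * PY b) - (Const \<i> * Const \<i> + 1) * (PY a * PY b)"
    by (simp add: PE_def algebra_simps)
  also have "\<dots> = (PX (a + b) - PX a * PX b + PY a * PY b)
      + Const \<i> * (PY (a + b) - PY a * PX b - PX a * PY b)"
    by (simp only: Const_ii) simp
  also have "\<dots> \<in> ideal_gens"
    by (intro ideal_add ideal_mult ideal_base Aring_Const) (use assms in \<open>auto simp: gens_def\<close>)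
  finally show ?thesis .
qed

lemma PE_mult_PF:
  assumes "algebraic a"
  shows "PE a * PF a - 1 \<in> ideal_gens"
proof -
  have "PE a * PF a - 1 = (PX a ^ 2 + PY a ^ 2 - 1) - (Const \<i> * Const \<i> + 1) * PY a ^ 2"
    by (simp add: PE_def PF_def algebra_simps power2_eq_square)
  also have "\<dots> = PX a ^ 2 + PY a ^ 2 - 1"
    by (simp only: Const_ii) simp
  also have "\<dots> \<in> ideal_gens"
    by (rule ideal_base) (use assms in \<open>auto simp: gens_def\<close>)
  finally show ?thesis .
qed

text \<open>Modulo the ideal, \<open>PE 0\<close> is idempotent by \<open>PE_add\<close> and
  invertible by \<open>PE_mult_PF\<close>, hence 1.\<close>

lemma PE_0: "PE 0 - 1 \<in> ideal_gens"
proof -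
  have "PE 0 - 1 = (PE 0 * PF 0 - 1) - PF 0 * (PE (0 + 0) - PE 0 * PE 0) - PE 0 * (PE 0 * PF 0 - 1)"
    by (simp add: algebra_simps)
  also have "\<dots> \<in> ideal_gens"
    by (intro ideal_diff ideal_mult PE_mult_PF PE_add Aring_PE Aring_PF) auto
  finally show ?thesis .
qed

text \<open>Both are inverses of \<open>PE a\<close> modulo the ideal, and inverses are
  unique.\<close>

lemma PF_eq:
  assumes "algebraic a"
  shows "PF a - PE (- a) \<in> ideal_gens"
proof -
  have "PE a * PE (- a) - 1 = (PE 0 - 1) - (PE (a + - a) - PE a * PE (- a))"
    by simp
  also have "\<dots> \<in> ideal_gens"
    by (intro ideal_diff PE_0 PE_add assms algebraic_minus)
  finally have "PE (- a) * (PE a * PF a - 1) - PF a * (PE a * PE (- a) - 1) \<in> ideal_gens"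
    by (rule ideal_diff[OF ideal_mult[OF Aring_PE[OF algebraic_minus[OF assms]] PE_mult_PF[OF assms]]
          ideal_mult[OF Aring_PF[OF assms]]])
  also have "PE (- a) * (PE a * PF a - 1) - PF a * (PE a * PE (- a) - 1) = PF a - PE (- a)"
    by (simp add: algebra_simps)
  finally show ?thesis .
qed

section \<open>Reduction to linear combinations of exponentials\<close>

inductive_set PE_span :: "mpoly set" where
  zero: "0 \<in> PE_span"
| step: "q \<in> PE_span \<Longrightarrow> algebraic c \<Longrightarrow> algebraic a \<Longrightarrow> q + Const c * PE a \<in> PE_span"

lemma PE_span_single: "algebraic c \<Longrightarrow> algebraic a \<Longrightarrow> Const c * PE a \<in> PE_span"
  using PE_span.step[OF PE_span.zero] by simp

lemma PE_span_subset_Aring: "q \<in> PE_span \<Longrightarrow> q \<in> Aring"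
  by (induction rule: PE_span.induct) (auto intro: Aring_0 Aring_add Aring_mult Aring_Const Aring_PE)

lemma PE_span_add:
  assumes "p \<in> PE_span" "q \<in> PE_span"
  shows "p + q \<in> PE_span"
  using assms(2)
proof (induction rule: PE_span.induct)
  case (step q c a)
  then show ?case
    using PE_span.step[of "p + q" c a] by (simp add: add.assoc)
qed (simp add: assms(1))

definition PE_reducible :: "mpoly set" where
  "PE_reducible = {p. \<exists>q\<in>PE_span. p - q \<in> ideal_gens}"

lemma PE_span_subset_reducible: "q \<in> PE_span \<Longrightarrow> q \<in> PE_reducible"
  unfolding PE_reducible_def using gen_ideal.zero by (auto intro!: bexI[of _ q])

lemma PE_reducible_cong: "q \<in> PE_reducible \<Longrightarrow> p - q \<in> ideal_gens \<Longrightarrow> p \<in> PE_reducible"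
  unfolding PE_reducible_def using ideal_add[of "p - q"] by fastforce

lemma PE_reducible_add:
  assumes "p \<in> PE_reducible" "p' \<in> PE_reducible"
  shows "p + p' \<in> PE_reducible"
proof -
  obtain q q' where "q \<in> PE_span" "p - q \<in> ideal_gens" "q' \<in> PE_span" "p' - q' \<in> ideal_gens"
    using assms by (auto simp: PE_reducible_def)
  then have "q + q' \<in> PE_span" "(p + p') - (q + q') \<in> ideal_gens"
    using PE_span_add ideal_add[of "p - q" "p' - q'"] by (auto simp: algebra_simps)
  then show ?thesis
    by (auto simp: PE_reducible_def)
qed

lemma PE_reducible_sum: "(\<And>x. x \<in> X \<Longrightarrow> f x \<in> PE_reducible) \<Longrightarrow> (\<Sum>x\<in>X. f x) \<in> PE_reducible"
  by (induction X rule: infinite_finite_induct)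
    (auto intro: PE_reducible_add PE_span_subset_reducible[OF PE_span.zero])

lemma PE_span_mult_reducible:
  assumes "p \<in> PE_span" "q \<in> PE_span"
  shows "p * q \<in> PE_reducible"
proof -
  have single: "p * (Const d * PE b) \<in> PE_reducible" if "algebraic d" "algebraic b" for d b
    using assms(1)
  proof (induction rule: PE_span.induct)
    case zero
    then show ?case
      using PE_span_subset_reducible[OF PE_span.zero] by simp
  next
    case (step p c a)
    have "Const c * PE a * (Const d * PE b) - Const (c * d) * PE (a + b)
        = - (Const (c * d) * (PE (a + b) - PE a * PE b))"
      by (simp add: Const_mult algebra_simps)
    also have "\<dots> \<in> ideal_gens"
      using step that by (intro ideal_minus ideal_mult PE_add Aring_Const algebraic_mult)
    finally have diff: "Const c * PE a * (Const d * PE b) - Const (c * d) * PE (a + b) \<in> ideal_gens" .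
    have "Const (c * d) * PE (a + b) \<in> PE_reducible"
      using step.hyps that by (intro PE_span_subset_reducible PE_span_single algebraic_mult algebraic_add)
    then have "Const c * PE a * (Const d * PE b) \<in> PE_reducible"
      using diff by (rule PE_reducible_cong)
    then show ?case
      using PE_reducible_add[OF step.IH] by (simp add: distrib_right)
  qed
  show ?thesis
    using assms(2)
  proof (induction rule: PE_span.induct)
    case zero
    then show ?case
      using PE_span_subset_reducible[OF PE_span.zero] by simp
  next
    case (step q c a)
    then show ?case
      using PE_reducible_add single by (simp add: distrib_left)
  qed
qed

text \<open>The factor \<open>p'\<close> multiplies the ideal element \<open>p - q\<close>, and the
  ideal absorbs only elements of \<open>Aring\<close>; hence the third hypothesis.\<close>

lemma PE_reducible_mult:
  assumes "p \<in> PE_reducible" "p' \<in> PE_reducible" "p' \<in> Aring"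
  shows "p * p' \<in> PE_reducible"
proof -
  obtain q q' where q: "q \<in> PE_span" "p - q \<in> ideal_gens" "q' \<in> PE_span" "p' - q' \<in> ideal_gens"
    using assms by (auto simp: PE_reducible_def)
  have "p * p' - q * q' = p' * (p - q) + q * (p' - q')"
    by (simp add: algebra_simps)
  also have "\<dots> \<in> ideal_gens"
    by (rule ideal_add[OF ideal_mult[OF assms(3) q(2)] ideal_mult[OF PE_span_subset_Aring[OF q(1)] q(4)]])
  finally show ?thesis
    using PE_span_mult_reducible[OF q(1,3)] by (rule PE_reducible_cong[rotated])
qed

lemma PE_reducible_Const:
  assumes "algebraic c"
  shows "Const c \<in> PE_reducible"
proof (rule PE_reducible_cong)
  show "Const c * PE 0 \<in> PE_reducible"
    using assms by (intro PE_span_subset_reducible PE_span_single) auto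
  have "Const c - Const c * PE 0 = - (Const c * (PE 0 - 1))"
    by (simp add: algebra_simps)
  also have "\<dots> \<in> ideal_gens"
    by (intro ideal_minus ideal_mult PE_0 Aring_Const assms)
  finally show "Const c - Const c * PE 0 \<in> ideal_gens" .
qed

text \<open>Euler's formula for the cosine, with \<open>PF a\<close> replaced by
  \<open>PE (- a)\<close>.\<close>

lemma PE_reducible_PX:
  assumes "algebraic a"
  shows "PX a \<in> PE_reducible"
proof (rule PE_reducible_cong)
  have alg: "algebraic (1 / 2 :: complex)"
    by (intro rat_imp_algebraic) simp
  show "Const (1 / 2) * PE a + Const (1 / 2) * PE (- a) \<in> PE_reducible"
    using assms alg by (intro PE_span_subset_reducible PE_span_add PE_span_single algebraic_minus)
  have "Const (1 / 2) * (PE a + PF a) = Const (1 / 2 + 1 / 2) * PX a"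
    by (simp only: PE_def PF_def Const_add) (simp add: algebra_simps)
  then have "PX a - (Const (1 / 2) * PE a + Const (1 / 2) * PE (- a)) = Const (1 / 2) * (PF a - PE (- a))"
    by (simp add: algebra_simps)
  also have "\<dots> \<in> ideal_gens"
    by (intro ideal_mult PF_eq Aring_Const alg assms)
  finally show "PX a - (Const (1 / 2) * PE a + Const (1 / 2) * PE (- a)) \<in> ideal_gens" .
qed

lemma PE_reducible_PY:
  assumes "algebraic a"
  shows "PY a \<in> PE_reducible"
proof (rule PE_reducible_cong)
  \<comment> \<open>\<open>k\<close> is 1/(2i), the coefficient in Euler's formula for the
    sine.\<close>
  define k where "k = - \<i> / 2"
  have alg: "algebraic k" "algebraic (- k)"
    using algebraic_mult[of "- \<i>" "1 / 2"] rat_imp_algebraic[of "1 / 2 :: complex"] by (auto simp: k_def)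
  show "Const k * PE a + Const (- k) * PE (- a) \<in> PE_reducible"
    using assms alg by (intro PE_span_subset_reducible PE_span_add PE_span_single algebraic_minus)
  have "Const k * (PE a - PF a) = Const (k * \<i> + k * \<i>) * PY a"
    by (simp only: PE_def PF_def Const_add Const_mult) (simp add: algebra_simps)
  also have "k * \<i> + k * \<i> = 1"
    by (simp add: k_def)
  finally have "PY a - (Const k * PE a + Const (- k) * PE (- a)) = - (Const k * (PF a - PE (- a)))"
    by (simp add: Const_minus algebra_simps)
  also have "\<dots> \<in> ideal_gens"
    by (intro ideal_minus ideal_mult PF_eq Aring_Const alg assms)
  finally show "PY a - (Const k * PE a + Const (- k) * PE (- a)) \<in> ideal_gens" .
qed

lemma PE_reducible_PVar: "algebraic (var_index v) \<Longrightarrow> PVar v \<in> PE_reducible"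
  using PE_reducible_PX PE_reducible_PY by (cases v) (auto simp: PX_def PY_def)

lemma PE_reducible_1: "1 \<in> PE_reducible"
  using PE_reducible_Const[of 1] by simp

lemma PE_reducible_power:
  assumes "p \<in> PE_reducible" "p \<in> Aring"
  shows "p ^ n \<in> PE_reducible \<and> p ^ n \<in> Aring"
  by (induction n) (use assms in \<open>auto intro: PE_reducible_1 PE_reducible_mult Aring_1 Aring_mult\<close>)

lemma PE_reducible_prod:
  assumes "\<And>x. x \<in> X \<Longrightarrow> f x \<in> PE_reducible \<and> f x \<in> Aring"
  shows "(\<Prod>x\<in>X. f x) \<in> PE_reducible \<and> (\<Prod>x\<in>X. f x) \<in> Aring"
  using assms
  by (induction X rule: infinite_finite_induct) (auto intro: PE_reducible_1 PE_reducible_mult Aring_1 Aring_mult)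

lemma single_eq_prod_PVar:
  "Poly_Mapping.single m c = Const c * (\<Prod>v\<in>Poly_Mapping.keys m. PVar v ^ Poly_Mapping.lookup m v)"
proof -
  have power: "PVar v ^ k = Poly_Mapping.single (Poly_Mapping.single v k) 1" for v k
    by (induction k) (simp_all add: PVar_def mult_single single_add[symmetric])
  have "(\<Prod>v\<in>V. PVar v ^ h v) = Poly_Mapping.single (\<Sum>v\<in>V. Poly_Mapping.single v (h v)) 1" for V and h :: "var \<Rightarrow> nat"
    by (induction V rule: infinite_finite_induct) (simp_all add: power mult_single)
  then show ?thesis
    by (simp add: sum_singles Const_def mult_single)
qed

lemma Aring_subset_reducible:
  assumes "p \<in> Aring"
  shows "p \<in> PE_reducible"
proof -
  have "Poly_Mapping.single m (Poly_Mapping.lookup p m) \<in> PE_reducible" if m: "m \<in> Poly_Mapping.keys p" for m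
    unfolding single_eq_prod_PVar
  proof (intro PE_reducible_mult PE_reducible_Const)
    show "algebraic (Poly_Mapping.lookup p m)"
      using assms by (simp add: Aring_def)
    have "PVar v ^ Poly_Mapping.lookup m v \<in> PE_reducible \<and> PVar v ^ Poly_Mapping.lookup m v \<in> Aring"
      if "v \<in> Poly_Mapping.keys m" for v
      using assms m that by (intro PE_reducible_power PE_reducible_PVar Aring_PVar) (auto simp: Aring_def)
    note prod = PE_reducible_prod[of "Poly_Mapping.keys m", OF this]
    show "(\<Prod>v\<in>Poly_Mapping.keys m. PVar v ^ Poly_Mapping.lookup m v) \<in> PE_reducible"
      "(\<Prod>v\<in>Poly_Mapping.keys m. PVar v ^ Poly_Mapping.lookup m v) \<in> Aring"
      using prod by simp_all
  qed
  then have "(\<Sum>m\<in>Poly_Mapping.keys p. Poly_Mapping.single m (Poly_Mapping.lookup p m)) \<in> PE_reducible"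
    by (rule PE_reducible_sum)
  then show ?thesis
    by (simp only: sum_singles)
qed

section \<open>Injectivity of evaluation on combinations of exponentials\<close>

lemma PE_span_collect:
  assumes "q \<in> PE_span"
  obtains S c where "finite S" "\<And>a. a \<in> S \<Longrightarrow> algebraic a" "\<And>a. algebraic (c a)"
    "q = (\<Sum>a\<in>S. Const (c a) * PE a)"
proof -
  have "\<exists>S c. finite S \<and> (\<forall>a\<in>S. algebraic a) \<and> (\<forall>a. algebraic (c a)) \<and> q = (\<Sum>a\<in>S. Const (c a) * PE a)"
    using assms
  proof (induction rule: PE_span.induct)
    case zero
    show ?case
      by (intro exI[of _ "{}"] exI[of _ "\<lambda>_. 0"]) simp
  next
    case (step q d b)
    then obtain S c where S: "finite S" "\<forall>a\<in>S. algebraic a" "\<forall>a. algebraic (c a)"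
      "q = (\<Sum>a\<in>S. Const (c a) * PE a)"
      by blast
    \<comment> \<open>\<open>c\<close> may take any value at a new \<open>b\<close> outside
      \<open>S\<close>; cutting it to 0 there allows \<open>d\<close> to be added.\<close>
    define c' where "c' a = (if a \<in> S then c a else 0)" for a
    define c'' where "c'' a = c' a + (if a = b then d else 0)" for a
    have "q = (\<Sum>a\<in>insert b S. Const (c' a) * PE a)"
      unfolding S(4) by (rule sum.mono_neutral_cong_left) (use S(1) in \<open>auto simp: c'_def\<close>)
    moreover have "Const d * PE b = (\<Sum>a\<in>insert b S. Const (if a = b then d else 0) * PE a)"
      using S(1) by (simp add: if_distrib[of Const] if_distrib[of "\<lambda>x. x * _"] cong: if_cong)
    ultimately have "q + Const d * PE b = (\<Sum>a\<in>insert b S. Const (c'' a) * PE a)"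
      by (simp add: c''_def Const_add distrib_right sum.distrib del: sum.insert)
    moreover have "algebraic (c'' a)" for a
      using S(3) step.hyps by (auto simp: c''_def c'_def intro: algebraic_add)
    ultimately show ?case
      using S(1,2) step.hyps by (intro exI[of _ "insert b S"] exI[of _ c'']) auto
  qed
  then show ?thesis
    using that by blast
qed

text \<open>Once equal indices are collected, the exponents i a are distinct and algebraic, so
  Lindemann-Weierstrass kills every coefficient.\<close>

lemma ev_PE_span_eq_0:
  assumes "q \<in> PE_span" "ev q = 0"
  shows "q = 0"
proof -
  obtain S c where S: "finite S" "\<And>a. a \<in> S \<Longrightarrow> algebraic a" "\<And>a. algebraic (c a)"
    and q: "q = (\<Sum>a\<in>S. Const (c a) * PE a)"
    using PE_span_collect[OF assms(1)] by blast
  have inj: "inj_on (\<lambda>a. \<i> * a) S"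
    by (auto simp: inj_on_def)
  have "(\<Sum>z\<in>(\<lambda>a. \<i> * a) ` S. c (z / \<i>) * exp z) = ev q"
    by (simp add: sum.reindex[OF inj] q ev_sum ev_mult ev_PE)
  then have sum_0: "(\<Sum>z\<in>(\<lambda>a. \<i> * a) ` S. c (z / \<i>) * exp z) = 0"
    using assms(2) by simp
  have "c a = 0" if "a \<in> S" for a
  proof -
    have "c (\<i> * a / \<i>) = 0"
      by (rule Lindemann_Weierstrass[OF _ _ _ sum_0])
        (use S that in \<open>auto intro: algebraic_mult\<close>)
    then show ?thesis
      by simp
  qed
  then show ?thesis
    by (simp add: q)
qed

text \<open>An element of the kernel is congruent to a combination of exponentials that also
  evaluates to 0 and is therefore 0.\<close>

theorem theorem1:
  shows "gen_ideal Aring gens \<subseteq> {p \<in> Aring. ev p = 0} \<and>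
         {p \<in> Aring. ev p = 0} = gen_ideal Aring gens"
proof -
  have "p \<in> ideal_gens" if p: "p \<in> Aring" "ev p = 0" for p
  proof -
    obtain q where q: "q \<in> PE_span" "p - q \<in> ideal_gens"
      using Aring_subset_reducible[OF p(1)] by (auto simp: PE_reducible_def)
    have "ev (p - q) = 0"
      using ideal_subset q(2) by blast
    then have "ev q = 0"
      using p(2) by (simp add: ev_diff)
    then have "q = 0"
      using ev_PE_span_eq_0[OF q(1)] by simp
    then show ?thesis
      using q(2) by simp
  qed
  then show ?thesis
    using ideal_subset by blast
qed

end
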